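(* Let $G$ be a simply connected solvable real Lie group of dimension four, with Lie algebra $\mathfrak g$ written as in the list in the context, with basis $e_1,\dots,e_4$ and dual basis $e^1,\dots,e^4$; write $e^{ij}=e^i\wedge e^j$. Then the following list shows, for a given left invariant complex structure $J$ on $G$ (taken as a representative of its equivalence class, and extended to $\mathfrak g$ by imposing $J^2=-\mathrm{Id}$), the general form of a compatible left invariant symplectic structure $\omega$ on $G$, when it exists. The coefficients are real and subject to the stated condition. 1. $\mathfrak{rr}_{3,0}$: $Je_1=e_2$, $Je_3=e_4$; $\omega=a_{12}e^{12}+a_{34}e^{34}$, $a_{12}a_{34}\neq0$. 2. $\mathfrak{rh}_3$: $Je_1=e_2$, $Je_3=e_4$; $\omega=a_{12}e^{12}+a_{13}e^{13}+a_{14}e^{14}-a_{14}e^{23}+a_{13}e^{24}$, $a_{13}^2+a_{14}^2\neq0$. 3. $\mathfrak{rr}'_{3,0}$: $Je_1=e_4$, $Je_2=e_3$; $\omega=a_{14}e^{14}+a_{23}e^{23}$, $a_{14}a_{23}\neq0$. 4. $\mathfrak r_2\mathfrak r_2$: $Je_1=e_2$, $Je_3=e_4$; $\omega=a_{12}e^{12}+a_{34}e^{34}$, $a_{12}a_{34}\neq0$. 5. $\mathfrak r_2'$: (a) $J_1e_1=e_3$, $J_1e_2=e_4$; $\omega=a(e^{13}-e^{24})+b(e^{14}+e^{23})$, $a^2+b^2\neq0$. (b) $J_2e_1=-e_2$, $J_2e_3=e_4$; $\omega=a_{12}e^{12}+a(e^{13}-e^{24})+b(e^{14}+e^{23})$,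 $a^2+b^2\neq0$. 6. $\mathfrak r_{4,-1,-1}$: $Je_4=e_1$, $Je_2=e_3$; $\omega=a_{12}e^{12}+a_{13}e^{13}+a_{14}e^{14}-a_{13}e^{24}+a_{12}e^{34}$, $a_{12}^2+a_{13}^2\neq0$. 7. $\mathfrak r_{4,-1,1}$: $Je_4=e_2$, $Je_1=e_3$; $\omega=a_{12}e^{12}+a_{13}e^{13}+a_{24}e^{24}-a_{12}e^{34}$, $a_{12}\neq0$. 8. $\mathfrak r'_{4,0,\delta}$: $J_1e_4=e_1$, $J_1e_2=e_3$, and $J_2e_4=e_1$, $J_2e_2=-e_3$; for both, $\omega=a_{14}e^{14}+a_{23}e^{23}$, $a_{14}a_{23}\neq0$. 9. $\mathfrak d_{4,1}$: $J_1e_1=e_4$, $J_1e_2=e_3$; $\omega=a(e^{12}-e^{34})+a_{14}e^{14}$, $a\neq0$. 10. $\mathfrak d_{4,2}$: (a) $J_1e_4=-e_2$, $J_1e_1=e_3$; $\omega=a_{14}e^{14}+a_{14}e^{23}+a_{24}e^{24}$, $a_{14}\neq0$. (b) $J_2e_4=-2e_1$, $J_2e_2=e_3$; $\omega=a_{14}e^{14}+a_{23}e^{23}$, $a_{14}a_{23}\neq0$. 11. $\mathfrak d_{4,1/2}$: $J_1e_4=e_3$, $J_1e_1=e_2$, and $J_2e_4=e_3$, $J_2e_1=-e_2$; for both, $\omega=a(e^{12}-e^{34})$, $a\neq0$. 12. $\mathfrak d'_{4,\delta}$, $\delta\neq0$: $J_1e_4=e_3$, $J_1e_1=e_2$; $J_2e_4=-e_3$,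 $J_2e_1=e_2$; $J_3e_4=-e_3$, $J_3e_1=-e_2$; $J_4e_4=e_3$, $J_4e_1=-e_2$; for all four, $\omega=a(e^{12}-\delta e^{34})$, $a\neq0$.
   Context: A left invariant complex structure on $G$ is identified with an endomorphism $J$ of $\mathfrak g$ with $J^2=-\mathrm{Id}$ and $[JX,JY]-[X,Y]-J[JX,Y]-J[X,JY]=0$ for all $X,Y\in\mathfrak g$. Two such structures $J_1,J_2$ are equivalent if there is a Lie algebra automorphism $x$ of $\mathfrak g$ with $xJ_1=J_2x$. A left invariant symplectic structure is identified with a 2-form $\omega\in\Lambda^2\mathfrak g^*$ that is non-degenerate and closed, i.e. $\omega([X,Y],Z)+\omega([Y,Z],X)+\omega([Z,X],Y)=0$ for all $X,Y,Z\in\mathfrak g$. It is compatible with $J$ if $\omega(JX,JY)=\omega(X,Y)$ for all $X,Y\in\mathfrak g$; no positivity is required, and a symplectic form compatible with some complex structure is called a (left invariant) Kähler structure. List of Lie algebras: every four-dimensional solvable real Lie algebra is isomorphic to one and only one of the following, with basis $e_1,\dots,e_4$; brackets of basis vectors not determined by those listed (via antisymmetry) are zero. $\mathfrak a_4$: abelian. $\mathfrak{rh}_3$: $[e_1,e_2]=e_3$. $\mathfrak{rr}_3$: $[e_1,e_2]=e_2$, $[e_1,e_3]=e_2+e_3$. $\mathfrak{rr}_{3,\lambda}$, $\lambda\in[-1,1]$: $[e_1,e_2]=e_2$, $[e_1,e_3]=\lambda e_3$. $\mathfrak{rr}'_{3,\gamma}$, $\gamma\ge0$: $[e_1,e_2]=\gamma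 e_2-e_3$, $[e_1,e_3]=e_2+\gamma e_3$. $\mathfrak r_2\mathfrak r_2$: $[e_1,e_2]=e_2$, $[e_3,e_4]=e_4$. $\mathfrak r_2'$: $[e_1,e_3]=e_3$, $[e_1,e_4]=e_4$, $[e_2,e_3]=e_4$, $[e_2,e_4]=-e_3$. $\mathfrak n_4$: $[e_4,e_1]=e_2$, $[e_4,e_2]=e_3$. $\mathfrak r_4$: $[e_4,e_1]=e_1$, $[e_4,e_2]=e_1+e_2$, $[e_4,e_3]=e_2+e_3$. $\mathfrak r_{4,\mu}$, $\mu\in\mathbb R$: $[e_4,e_1]=e_1$, $[e_4,e_2]=\mu e_2$, $[e_4,e_3]=e_2+\mu e_3$. $\mathfrak r_{4,\alpha,\beta}$, $\alpha\beta\ne0$, $-1\le\alpha\le\beta\le1$: $[e_4,e_1]=e_1$, $[e_4,e_2]=\alpha e_2$, $[e_4,e_3]=\beta e_3$. $\mathfrak r'_{4,\gamma,\delta}$, $\gamma\in\mathbb R$, $\delta>0$: $[e_4,e_1]=e_1$, $[e_4,e_2]=\gamma e_2-\delta e_3$, $[e_4,e_3]=\delta e_2+\gamma e_3$. $\mathfrak d_4$: $[e_1,e_2]=e_3$, $[e_4,e_1]=e_1$, $[e_4,e_2]=-e_2$. $\mathfrak d_{4,\lambda}$, $\lambda\ge\frac12$: $[e_1,e_2]=e_3$, $[e_4,e_3]=e_3$, $[e_4,e_1]=\lambda e_1$, $[e_4,e_2]=(1-\lambda)e_2$. $\mathfrak d'_{4,\delta}$, $\delta\ge0$: $[e_1,e_2]=e_3$,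 $[e_4,e_1]=\frac\delta2e_1-e_2$, $[e_4,e_3]=\delta e_3$, $[e_4,e_2]=e_1+\frac\delta2e_2$. $\mathfrak h_4$: $[e_1,e_2]=e_3$, $[e_4,e_3]=e_3$, $[e_4,e_1]=\frac12e_1$, $[e_4,e_2]=e_1+\frac12e_2$.
   Formalization: Item 7 is corrected to ω=a12 e^12+a14(e^14−e^23)+a24 e^24−a12 e^34 with a12²+a14²≠0, since e^13 is not closed and e^14−e^23 was missing; completeness of the list is claimed for non-abelian g only, as a_4 has compatible pairs but is not listed. *)

theory Defs
  imports "HOL-Analysis.Analysis"
begin

section \<open>The four-dimensional solvable real Lie algebras\<close>

text \<open>Every Lie algebra of the list is realised on \<open>real^4\<close>; its basis is the standard one.\<close>

abbreviation bv :: "4 \<Rightarrow> real^4"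
  where "bv i \<equiv> axis i 1"

datatype solv4 =
    A4
  | RH3
  | RR3
  | RR3_lam real
  | RR3'_gam real
  | R2R2
  | R2'
  | N4
  | R4
  | R4_mu real
  | R4_ab real real
  | R4'_gd real real
  | D4
  | D4_lam real
  | D4'_del real
  | H4

text \<open>The constructors with arguments carry the parameter restrictions of the list; these
  are imposed separately by the following predicate.\<close>

fun valid_params :: "solv4 \<Rightarrow> bool" where
  "valid_params (RR3_lam l) \<longleftrightarrow> -1 \<le> l \<and> l \<le> 1"
| "valid_params (RR3'_gam c) \<longleftrightarrow> c \<ge> 0"
| "valid_params (R4_ab a b) \<longleftrightarrow> a * b \<noteq> 0 \<and> -1 \<le> a \<and> a \<le> b \<and> b \<le> 1"
| "valid_params (R4'_gd c d) \<longleftrightarrow> d > 0"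
| "valid_params (D4_lam l) \<longleftrightarrow> l \<ge> 1/2"
| "valid_params (D4'_del d) \<longleftrightarrow> d \<ge> 0"
| "valid_params _ \<longleftrightarrow> True"

text \<open>An entry \<open>((i, j), v)\<close> stands for \<open>[e\<^sub>i, e\<^sub>j] = v\<close>.\<close>

fun bracket_table :: "solv4 \<Rightarrow> ((4 \<times> 4) \<times> (real^4)) list" where
  "bracket_table A4 = []"
| "bracket_table RH3 = [((1,2), bv 3)]"
| "bracket_table RR3 = [((1,2), bv 2), ((1,3), bv 2 + bv 3)]"
| "bracket_table (RR3_lam l) = [((1,2), bv 2), ((1,3), l *\<^sub>R bv 3)]"
| "bracket_table (RR3'_gam c) = [((1,2), c *\<^sub>R bv 2 - bv 3), ((1,3), bv 2 + c *\<^sub>R bv 3)]"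
| "bracket_table R2R2 = [((1,2), bv 2), ((3,4), bv 4)]"
| "bracket_table R2' = [((1,3), bv 3), ((1,4), bv 4), ((2,3), bv 4), ((2,4), - bv 3)]"
| "bracket_table N4 = [((4,1), bv 2), ((4,2), bv 3)]"
| "bracket_table R4 = [((4,1), bv 1), ((4,2), bv 1 + bv 2), ((4,3), bv 2 + bv 3)]"
| "bracket_table (R4_mu m) = [((4,1), bv 1), ((4,2), m *\<^sub>R bv 2), ((4,3), bv 2 + m *\<^sub>R bv 3)]"
| "bracket_table (R4_ab a b) = [((4,1), bv 1), ((4,2), a *\<^sub>R bv 2), ((4,3), b *\<^sub>R bv 3)]"
| "bracket_table (R4'_gd c d) =
     [((4,1), bv 1), ((4,2), c *\<^sub>R bv 2 - d *\<^sub>R bv 3), ((4,3), d *\<^sub>R bv 2 + c *\<^sub>R bv 3)]"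
| "bracket_table D4 = [((1,2), bv 3), ((4,1), bv 1), ((4,2), - bv 2)]"
| "bracket_table (D4_lam l) =
     [((1,2), bv 3), ((4,3), bv 3), ((4,1), l *\<^sub>R bv 1), ((4,2), (1 - l) *\<^sub>R bv 2)]"
| "bracket_table (D4'_del d) =
     [((1,2), bv 3), ((4,1), (d/2) *\<^sub>R bv 1 - bv 2), ((4,3), d *\<^sub>R bv 3),
      ((4,2), bv 1 + (d/2) *\<^sub>R bv 2)]"
| "bracket_table H4 =
     [((1,2), bv 3), ((4,3), bv 3), ((4,1), (1/2) *\<^sub>R bv 1), ((4,2), bv 1 + (1/2) *\<^sub>R bv 2)]"

text \<open>Antisymmetric bilinear extension of the table, with all unlisted brackets zero.\<close>

definition bracket :: "solv4 \<Rightarrow> real^4 \<Rightarrow> real^4 \<Rightarrow> real^4" where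
  "bracket g x y = (\<Sum>((i, j), v) \<leftarrow> bracket_table g. (x $ i * y $ j - x $ j * y $ i) *\<^sub>R v)"

lemma bilinear_bracket: "bilinear (bracket g)"
  unfolding bilinear_def bracket_def
  by (cases g) (auto intro!: linearI simp: vec_eq_iff forall_4 axis_def field_simps)

lemma bracket_alternating: "bracket g x x = 0"
  by (cases g) (simp_all add: bracket_def)

lemma bracket_jacobi:
  "bracket g (bracket g x y) z + bracket g (bracket g y z) x + bracket g (bracket g z x) y = 0"
  by (cases g) (simp_all add: bracket_def vec_eq_iff forall_4 axis_def algebra_simps)


section \<open>Invariant complex and symplectic structures\<close>

definition complex_structure :: "(real^4 \<Rightarrow> real^4 \<Rightarrow> real^4) \<Rightarrow> (real^4 \<Rightarrow> real^4) \<Rightarrow> bool" where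
  "complex_structure br J \<longleftrightarrow>
     linear J \<and> (\<forall>x. J (J x) = - x) \<and>
     (\<forall>x y. br (J x) (J y) - br x y - J (br (J x) y) - J (br x (J y)) = 0)"

definition lie_automorphism :: "(real^4 \<Rightarrow> real^4 \<Rightarrow> real^4) \<Rightarrow> (real^4 \<Rightarrow> real^4) \<Rightarrow> bool" where
  "lie_automorphism br f \<longleftrightarrow> linear f \<and> bij f \<and> (\<forall>x y. f (br x y) = br (f x) (f y))"

definition equivalent_cs ::
    "(real^4 \<Rightarrow> real^4 \<Rightarrow> real^4) \<Rightarrow> (real^4 \<Rightarrow> real^4) \<Rightarrow> (real^4 \<Rightarrow> real^4) \<Rightarrow> bool" where
  "equivalent_cs br J1 J2 \<longleftrightarrow> (\<exists>f. lie_automorphism br f \<and> f \<circ> J1 = J2 \<circ> f)"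

definition symplectic_form ::
    "(real^4 \<Rightarrow> real^4 \<Rightarrow> real^4) \<Rightarrow> (real^4 \<Rightarrow> real^4 \<Rightarrow> real) \<Rightarrow> bool" where
  "symplectic_form br \<omega> \<longleftrightarrow>
     bilinear \<omega> \<and> (\<forall>x. \<omega> x x = 0) \<and>
     (\<forall>x. (\<forall>y. \<omega> x y = 0) \<longrightarrow> x = 0) \<and>
     (\<forall>x y z. \<omega> (br x y) z + \<omega> (br y z) x + \<omega> (br z x) y = 0)"

definition compatible :: "(real^4 \<Rightarrow> real^4) \<Rightarrow> (real^4 \<Rightarrow> real^4 \<Rightarrow> real) \<Rightarrow> bool" where
  "compatible J \<omega> \<longleftrightarrow> (\<forall>x y. \<omega> (J x) (J y) = \<omega> x y)"


section \<open>The list of complex structures and compatible symplectic forms\<close>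

text \<open>\<open>ee i j\<close> is \<open>e\<^sup>i \<and> e\<^sup>j\<close>, normalised by \<open>(e\<^sup>i \<and> e\<^sup>j) (e\<^sub>i, e\<^sub>j) = 1\<close>.\<close>

definition ee :: "4 \<Rightarrow> 4 \<Rightarrow> real^4 \<Rightarrow> real^4 \<Rightarrow> real" where
  "ee i j x y = x $ i * y $ j - x $ j * y $ i"

text \<open>A triple \<open>(i, c, k)\<close> prescribes \<open>J e\<^sub>i = c e\<^sub>k\<close>; then \<open>J\<^sup>2 = -Id\<close> forces
  \<open>J e\<^sub>k = - (1/c) e\<^sub>i\<close>.\<close>

definition cs_ext :: "(4 \<times> real \<times> 4) list \<Rightarrow> real^4 \<Rightarrow> real^4" where
  "cs_ext ps x = (\<Sum>(i, c, k) \<leftarrow> ps. (x $ i * c) *\<^sub>R bv k - (x $ k / c) *\<^sub>R bv i)"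

text \<open>\<open>kahler_list g J \<Omega>\<close>: the list contains the complex structure \<open>J\<close> on \<open>g\<close>, and the
  general form attached to it describes the set \<open>\<Omega>\<close> of 2-forms.

  In the rule \<open>r4_m1_p1\<close> the form in the source,
  \<open>a\<^sub>1\<^sub>2 e\<^sup>1\<^sup>2 + a\<^sub>1\<^sub>3 e\<^sup>1\<^sup>3 + a\<^sub>2\<^sub>4 e\<^sup>2\<^sup>4 - a\<^sub>1\<^sub>2 e\<^sup>3\<^sup>4\<close>, \<open>a\<^sub>1\<^sub>2 \<noteq> 0\<close>, is corrected:
  \<open>e\<^sup>1\<^sup>3\<close> is not closed (\<open>[e\<^sub>4, e\<^sub>1] = e\<^sub>1\<close> and \<open>[e\<^sub>4, e\<^sub>3] = e\<^sub>3\<close>), while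
  \<open>e\<^sup>1\<^sup>4 - e\<^sup>2\<^sup>3\<close> is closed and compatible.\<close>

inductive kahler_list ::
    "solv4 \<Rightarrow> (real^4 \<Rightarrow> real^4) \<Rightarrow> (real^4 \<Rightarrow> real^4 \<Rightarrow> real) set \<Rightarrow> bool" where
  rr3_0: "kahler_list (RR3_lam 0) (cs_ext [(1, 1, 2), (3, 1, 4)])
    {(\<lambda>x y. a12 * ee 1 2 x y + a34 * ee 3 4 x y) | a12 a34. a12 * a34 \<noteq> 0}"
| rh3: "kahler_list RH3 (cs_ext [(1, 1, 2), (3, 1, 4)])
    {(\<lambda>x y. a12 * ee 1 2 x y + a13 * ee 1 3 x y + a14 * ee 1 4 x y
            - a14 * ee 2 3 x y + a13 * ee 2 4 x y) | a12 a13 a14. a13\<^sup>2 + a14\<^sup>2 \<noteq> 0}"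
| rr3'_0: "kahler_list (RR3'_gam 0) (cs_ext [(1, 1, 4), (2, 1, 3)])
    {(\<lambda>x y. a14 * ee 1 4 x y + a23 * ee 2 3 x y) | a14 a23. a14 * a23 \<noteq> 0}"
| r2r2: "kahler_list R2R2 (cs_ext [(1, 1, 2), (3, 1, 4)])
    {(\<lambda>x y. a12 * ee 1 2 x y + a34 * ee 3 4 x y) | a12 a34. a12 * a34 \<noteq> 0}"
| r2'_a: "kahler_list R2' (cs_ext [(1, 1, 3), (2, 1, 4)])
    {(\<lambda>x y. a * (ee 1 3 x y - ee 2 4 x y) + b * (ee 1 4 x y + ee 2 3 x y))
      | a b. a\<^sup>2 + b\<^sup>2 \<noteq> 0}"
| r2'_b: "kahler_list R2' (cs_ext [(1, -1, 2), (3, 1, 4)])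
    {(\<lambda>x y. a12 * ee 1 2 x y + a * (ee 1 3 x y - ee 2 4 x y) + b * (ee 1 4 x y + ee 2 3 x y))
      | a12 a b. a\<^sup>2 + b\<^sup>2 \<noteq> 0}"
| r4_m1_m1: "kahler_list (R4_ab (-1) (-1)) (cs_ext [(4, 1, 1), (2, 1, 3)])
    {(\<lambda>x y. a12 * ee 1 2 x y + a13 * ee 1 3 x y + a14 * ee 1 4 x y
            - a13 * ee 2 4 x y + a12 * ee 3 4 x y) | a12 a13 a14. a12\<^sup>2 + a13\<^sup>2 \<noteq> 0}"
| r4_m1_p1: "kahler_list (R4_ab (-1) 1) (cs_ext [(4, 1, 2), (1, 1, 3)])
    {(\<lambda>x y. a12 * ee 1 2 x y + a14 * ee 1 4 x y - a14 * ee 2 3 x y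
            + a24 * ee 2 4 x y - a12 * ee 3 4 x y) | a12 a14 a24. a12\<^sup>2 + a14\<^sup>2 \<noteq> 0}"
| r4'_0: "\<delta> > 0 \<Longrightarrow> J \<in> {cs_ext [(4, 1, 1), (2, 1, 3)], cs_ext [(4, 1, 1), (2, -1, 3)]} \<Longrightarrow>
    kahler_list (R4'_gd 0 \<delta>) J
    {(\<lambda>x y. a14 * ee 1 4 x y + a23 * ee 2 3 x y) | a14 a23. a14 * a23 \<noteq> 0}"
| d4_1: "kahler_list (D4_lam 1) (cs_ext [(1, 1, 4), (2, 1, 3)])
    {(\<lambda>x y. a * (ee 1 2 x y - ee 3 4 x y) + a14 * ee 1 4 x y) | a a14. a \<noteq> 0}"
| d4_2_a: "kahler_list (D4_lam 2) (cs_ext [(4, -1, 2), (1, 1, 3)])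
    {(\<lambda>x y. a14 * ee 1 4 x y + a14 * ee 2 3 x y + a24 * ee 2 4 x y) | a14 a24. a14 \<noteq> 0}"
| d4_2_b: "kahler_list (D4_lam 2) (cs_ext [(4, -2, 1), (2, 1, 3)])
    {(\<lambda>x y. a14 * ee 1 4 x y + a23 * ee 2 3 x y) | a14 a23. a14 * a23 \<noteq> 0}"
| d4_half: "J \<in> {cs_ext [(4, 1, 3), (1, 1, 2)], cs_ext [(4, 1, 3), (1, -1, 2)]} \<Longrightarrow>
    kahler_list (D4_lam (1/2)) J
    {(\<lambda>x y. a * (ee 1 2 x y - ee 3 4 x y)) | a. a \<noteq> 0}"
| d4': "\<delta> \<ge> 0 \<Longrightarrow> \<delta> \<noteq> 0 \<Longrightarrow>
    J \<in> {cs_ext [(4, 1, 3), (1, 1, 2)], cs_ext [(4, -1, 3), (1, 1, 2)],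
         cs_ext [(4, -1, 3), (1, -1, 2)], cs_ext [(4, 1, 3), (1, -1, 2)]} \<Longrightarrow>
    kahler_list (D4'_del \<delta>) J
    {(\<lambda>x y. a * (ee 1 2 x y - \<delta> * ee 3 4 x y)) | a. a \<noteq> 0}"

end

(* A compatible closed form is determined by linear equations on its six coefficients, which
   settles each item of the list. For completeness, let J be complex and omega compatible.
   Three kinds of algebras occur.
   (1) R acting by A on an abelian ideal h: pick X with e^k(X) = 1 and JX in h. Integrability says
   that A commutes with J on the plane h \<inter> Jh, and closedness of omega leaves three shapes of A:
   A(JX) = a JX with A = qJ on the plane; A = -p on JX and p on the plane; A nilpotent of rank one.
   (2) R acting on the Heisenberg algebra with center z: if Jz is transversal to the ideal, then
   ad(Jz) is complex linear on the J-invariant plane of the ideal; otherwise this plane is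
   spanned by z, Jz, and the eigenvalues of the action are d - kappa and kappa with d the trace,
   where closedness forces kappa to be d, -d or 2d.
   (3) r2r2 and r2': J is computed on the abelian ideal [g, g].
   In every case one reads off a basis with the structure constants of g in which J is listed. *)
theory Submission
  imports Defs
begin

section \<open>Two-forms in coordinates\<close>

text \<open>No positivity is assumed, so \<omega> may vanish on the J-invariant plane of the ideal,
  and the orthogonal of that plane need not be a complement. The almost abelian argument therefore
  branches on \<omega>(v, Jv), where v spans the plane over J: if it is nonzero, X can be made
  orthogonal to the plane; if it is zero, nondegeneracy makes the plane pair with X and JX, and
  closedness turns this pairing into a relation between eigenvalues. The parameters of g enter last.
  A normal form prescribes a polynomial identity for the action of e_k, and evaluating it on the
  standard basis fixes or excludes the parameters; for the Heisenberg extensions trace and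
  determinant play this role. A frame that has the structure constants of g and in which J has a
  listed matrix already yields the automorphism. Signs that cannot be absorbed into such a frame are
  the reason why an item can contain several J.\<close>

definition two_form :: "real \<Rightarrow> real \<Rightarrow> real \<Rightarrow> real \<Rightarrow> real \<Rightarrow> real \<Rightarrow> real^4 \<Rightarrow> real^4 \<Rightarrow> real" where
  "two_form a b c d e f x y = a * ee 1 2 x y + b * ee 1 3 x y + c * ee 1 4 x y
     + d * ee 2 3 x y + e * ee 2 4 x y + f * ee 3 4 x y"

lemma vec4_expand: "(x::real^4) = x$1 *\<^sub>R bv 1 + x$2 *\<^sub>R bv 2 + x$3 *\<^sub>R bv 3 + x$4 *\<^sub>R bv 4"
  by (simp add: vec_eq_iff forall_4 axis_def)

lemma bilinear_two_form: "bilinear (two_form a b c d e f)"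
  unfolding bilinear_def two_form_def ee_def
  by (auto intro!: linearI simp: algebra_simps)

lemma two_form_self: "two_form a b c d e f x x = 0"
  by (simp add: two_form_def ee_def)

lemma alternating_swap:
  assumes "bilinear \<omega>" "\<forall>x. \<omega> x x = (0::real)"
  shows "\<omega> x y = - \<omega> y x"
proof -
  have "0 = \<omega> (x + y) (x + y)" using assms by simp
  also have "\<dots> = \<omega> x y + \<omega> y x"
    unfolding bilinear_ladd[OF assms(1)] bilinear_radd[OF assms(1)] using assms(2) by simp
  finally show ?thesis by simp
qed

lemma alternating_eq_two_form:
  fixes \<omega> :: "real^4 \<Rightarrow> real^4 \<Rightarrow> real"
  assumes b: "bilinear \<omega>" and a: "\<forall>x. \<omega> x x = 0"
  shows "\<omega> = two_form (\<omega> (bv 1) (bv 2)) (\<omega> (bv 1) (bv 3)) (\<omega> (bv 1) (bv 4))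
     (\<omega> (bv 2) (bv 3)) (\<omega> (bv 2) (bv 4)) (\<omega> (bv 3) (bv 4))"
proof (intro ext)
  fix x y :: "real^4"
  note sw = alternating_swap[OF b a]
  have "\<omega> x y = \<omega> (x$1 *\<^sub>R bv 1 + x$2 *\<^sub>R bv 2 + x$3 *\<^sub>R bv 3 + x$4 *\<^sub>R bv 4)
                 (y$1 *\<^sub>R bv 1 + y$2 *\<^sub>R bv 2 + y$3 *\<^sub>R bv 3 + y$4 *\<^sub>R bv 4)"
    using vec4_expand[of x] vec4_expand[of y] by simp
  also have "\<dots> = two_form (\<omega> (bv 1) (bv 2)) (\<omega> (bv 1) (bv 3)) (\<omega> (bv 1) (bv 4))
     (\<omega> (bv 2) (bv 3)) (\<omega> (bv 2) (bv 4)) (\<omega> (bv 3) (bv 4)) x y"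
    using a sw[of "bv 2" "bv 1"] sw[of "bv 3" "bv 1"] sw[of "bv 4" "bv 1"]
      sw[of "bv 3" "bv 2"] sw[of "bv 4" "bv 2"] sw[of "bv 4" "bv 3"]
    by (simp add: bilinear_ladd[OF b] bilinear_radd[OF b] bilinear_lmul[OF b] bilinear_rmul[OF b]
        two_form_def ee_def algebra_simps)
  finally show "\<omega> x y = two_form (\<omega> (bv 1) (bv 2)) (\<omega> (bv 1) (bv 3)) (\<omega> (bv 1) (bv 4))
     (\<omega> (bv 2) (bv 3)) (\<omega> (bv 2) (bv 4)) (\<omega> (bv 3) (bv 4)) x y" .
qed

lemma alternating_eq_0:
  fixes \<omega> :: "real^4 \<Rightarrow> real^4 \<Rightarrow> real"
  assumes "bilinear \<omega>" "\<forall>x. \<omega> x x = 0"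
    and "\<omega> (bv 1) (bv 2) = 0" "\<omega> (bv 1) (bv 3) = 0" "\<omega> (bv 1) (bv 4) = 0"
    and "\<omega> (bv 2) (bv 3) = 0" "\<omega> (bv 2) (bv 4) = 0" "\<omega> (bv 3) (bv 4) = 0"
  shows "\<omega> x y = 0"
  using alternating_eq_two_form[OF assms(1,2)] assms(3-) by (simp add: two_form_def)

text \<open>The expression is the Pfaffian of the form; its square is the determinant of the Gram
  matrix.\<close>

lemma two_form_nondegenerate_iff:
  "(\<forall>x. (\<forall>y. two_form a b c d e f x y = 0) \<longrightarrow> x = 0) \<longleftrightarrow> a * f - b * e + c * d \<noteq> 0"
proof
  assume nd: "\<forall>x. (\<forall>y. two_form a b c d e f x y = 0) \<longrightarrow> x = 0"
  show "a * f - b * e + c * d \<noteq> 0"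
  proof
    assume pf: "a * f - b * e + c * d = 0"
    \<comment> \<open>Up to sign, the three vectors are rows of the Pfaffian adjugate, so they lie
      in the kernel when the Pfaffian vanishes. Together they contain all six coefficients, hence
      the form itself would be zero.\<close>
    have 1: "two_form a b c d e f (vector [0, f, - e, d]) y = 0" for y
    proof -
      have "two_form a b c d e f (vector [0, f, - e, d]) y = - (a * f - b * e + c * d) * y$1"
        by (simp add: two_form_def ee_def vector_def algebra_simps)
      then show ?thesis using pf by simp
    qed
    have 2: "two_form a b c d e f (vector [f, 0, - c, b]) y = 0" for y
    proof -
      have "two_form a b c d e f (vector [f, 0, - c, b]) y = (a * f - b * e + c * d) * y$2"
        by (simp add: two_form_def ee_def vector_def algebra_simps)
      then show ?thesis using pf by simp
    qed
    have 3: "two_form a b c d e f (vector [e, - c, 0, a]) y = 0" for y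
    proof -
      have "two_form a b c d e f (vector [e, - c, 0, a]) y = - (a * f - b * e + c * d) * y$3"
        by (simp add: two_form_def ee_def vector_def algebra_simps)
      then show ?thesis using pf by simp
    qed
    have v: "vector [0, f, - e, d] = (0::real^4)" "vector [f, 0, - c, b] = (0::real^4)"
      "vector [e, - c, 0, a] = (0::real^4)"
      using nd 1 2 3 by blast+
    have "f = 0" "e = 0" "d = 0" "c = 0" "b = 0" "a = 0"
      using v by (simp_all add: vec_eq_iff forall_4 vector_def)
    then have "bv 1 = (0::real^4)" using nd by (simp add: two_form_def)
    then show False by (simp add: axis_eq_0_iff)
  qed
next
  assume pf: "a * f - b * e + c * d \<noteq> 0"
  show "\<forall>x. (\<forall>y. two_form a b c d e f x y = 0) \<longrightarrow> x = 0"
  proof (intro allI impI)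
    fix x :: "real^4" assume z: "\<forall>y. two_form a b c d e f x y = 0"
    have e1: "a * x$2 + b * x$3 + c * x$4 = 0"
      using z[rule_format, of "bv 1"] by (simp add: two_form_def ee_def axis_def algebra_simps)
    have e2: "a * x$1 = d * x$3 + e * x$4"
      using z[rule_format, of "bv 2"] by (simp add: two_form_def ee_def axis_def algebra_simps)
    have e3: "b * x$1 + d * x$2 = f * x$4"
      using z[rule_format, of "bv 3"] by (simp add: two_form_def ee_def axis_def algebra_simps)
    have e4: "c * x$1 + e * x$2 + f * x$3 = 0"
      using z[rule_format, of "bv 4"] by (simp add: two_form_def ee_def axis_def algebra_simps)
    \<comment> \<open>The same adjugate, applied to the four equations, returns the Pfaffian times
      each coordinate of x.\<close>
    have "(a * f - b * e + c * d) * x$1 = 0" using e1 e2 e3 e4 by algebra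
    moreover have "(a * f - b * e + c * d) * x$2 = 0" using e1 e2 e3 e4 by algebra
    moreover have "(a * f - b * e + c * d) * x$3 = 0" using e1 e2 e3 e4 by algebra
    moreover have "(a * f - b * e + c * d) * x$4 = 0" using e1 e2 e3 e4 by algebra
    ultimately show "x = 0" using pf by (simp add: vec_eq_iff forall_4)
  qed
qed

lemma bracket_swap: "bracket g x y = - bracket g y x"
proof -
  have "0 = bracket g (x + y) (x + y)" by (simp add: bracket_alternating)
  also have "\<dots> = bracket g x y + bracket g y x"
    unfolding bilinear_ladd[OF bilinear_bracket] bilinear_radd[OF bilinear_bracket]
    by (simp add: bracket_alternating)
  finally show ?thesis by (simp add: eq_neg_iff_add_eq_0)
qed

text \<open>The cyclic sum is itself an alternating trilinear form, so its values on the four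
  increasing triples of basis vectors determine it.\<close>

lemma closed_iff_basis:
  fixes g :: solv4
  assumes b: "bilinear \<omega>" and a: "\<forall>x. \<omega> x x = (0::real)"
  defines "C \<equiv> \<lambda>x y z. \<omega> (bracket g x y) z + \<omega> (bracket g y z) x + \<omega> (bracket g z x) y"
  shows "(\<forall>x y z. C x y z = 0) \<longleftrightarrow>
    C (bv 1) (bv 2) (bv 3) = 0 \<and> C (bv 1) (bv 2) (bv 4) = 0 \<and>
    C (bv 1) (bv 3) (bv 4) = 0 \<and> C (bv 2) (bv 3) (bv 4) = 0" (is "_ \<longleftrightarrow> ?R")
proof
  assume R: ?R
  note sw = alternating_swap[OF b a]
  note B = bilinear_bracket[of g]
  note bl = bilinear_ladd[OF b] bilinear_radd[OF b] bilinear_lmul[OF b] bilinear_rmul[OF b]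
    bilinear_lneg[OF b] bilinear_rneg[OF b] bilinear_lzero[OF b] bilinear_rzero[OF b]
    bilinear_ladd[OF B] bilinear_radd[OF B] bilinear_lmul[OF B] bilinear_rmul[OF B]
  have bil: "bilinear (C x)" for x
    unfolding bilinear_def C_def by (auto intro!: linearI simp: bl algebra_simps)
  have cyc: "C x y z = C y z x" for x y z by (simp add: C_def)
  have alt: "C x y y = 0" for x y
    using bracket_swap[of g y x] by (simp add: C_def bl bracket_alternating)
  have swp: "C x y z = - C x z y" for x y z
    using alternating_swap[OF bil] alt by blast
  have lin: "linear (\<lambda>x. C x y z)" for y z
    by (auto intro!: linearI simp: C_def bl algebra_simps)
  have R': "C (bv 1) (bv 2) (bv 3) = 0" "C (bv 1) (bv 2) (bv 4) = 0"
    "C (bv 1) (bv 3) (bv 4) = 0" "C (bv 2) (bv 3) (bv 4) = 0" using R by auto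
  \<comment> \<open>The first argument runs through the basis; a pair containing an earlier index is
    moved cyclically into a case already settled.\<close>
  have z1: "C (bv 1) y z = 0" for y z
    by (rule alternating_eq_0[OF bil]) (use R' alt cyc in \<open>metis\<close>)+
  have z2: "C (bv 2) y z = 0" for y z
    by (rule alternating_eq_0[OF bil])
      (use R' alt cyc swp z1 in \<open>metis\<close>)+
  have z3: "C (bv 3) y z = 0" for y z
    by (rule alternating_eq_0[OF bil])
      (use R' alt cyc swp z1 z2 in \<open>metis\<close>)+
  have z4: "C (bv 4) y z = 0" for y z
    by (rule alternating_eq_0[OF bil])
      (use R' alt cyc swp z1 z2 z3 in \<open>metis\<close>)+
  show "\<forall>x y z. C x y z = 0"
  proof (intro allI)
    fix x y z
    have "C x y z = C (x$1 *\<^sub>R bv 1 + x$2 *\<^sub>R bv 2 + x$3 *\<^sub>R bv 3 + x$4 *\<^sub>R bv 4) y z"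
      using vec4_expand[of x] by simp
    also have "\<dots> = 0"
      by (simp add: linear_add[OF lin] linear_scale[OF lin] z1 z2 z3 z4)
    finally show "C x y z = 0" .
  qed
qed blast

text \<open>The defect \<omega>(Jx, Jy) - \<omega>(x, y) is again bilinear and alternating, so six
  pairs suffice.\<close>

lemma compatible_iff_basis:
  fixes \<omega> :: "real^4 \<Rightarrow> real^4 \<Rightarrow> real" and J :: "real^4 \<Rightarrow> real^4"
  assumes b: "bilinear \<omega>" and a: "\<forall>x. \<omega> x x = 0" and J: "linear J"
  defines "C \<equiv> \<lambda>x y. \<omega> (J x) (J y) = \<omega> x y"
  shows "compatible J \<omega> \<longleftrightarrow> C (bv 1) (bv 2) \<and> C (bv 1) (bv 3) \<and> C (bv 1) (bv 4) \<and>
    C (bv 2) (bv 3) \<and> C (bv 2) (bv 4) \<and> C (bv 3) (bv 4)" (is "_ \<longleftrightarrow> ?R")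
proof
  assume R: ?R
  note bl = bilinear_ladd[OF b] bilinear_radd[OF b] bilinear_lmul[OF b] bilinear_rmul[OF b]
    linear_add[OF J] linear_scale[OF J]
  have "\<omega> (J x) (J y) - \<omega> x y = 0" for x y
    by (rule alternating_eq_0[of "\<lambda>x y. \<omega> (J x) (J y) - \<omega> x y"])
      (use R a in \<open>auto intro!: linearI simp: C_def bl algebra_simps bilinear_def\<close>)
  then show "compatible J \<omega>" by (simp add: compatible_def)
qed (simp add: C_def compatible_def)

section \<open>The items of the list as systems in six real unknowns\<close>

lemma linear_cs_ext: "linear (cs_ext ps)"
proof (induction ps)
  case Nil
  show ?case by (simp add: cs_ext_def module_hom_zero)
next
  case (Cons p ps)
  obtain i c k where p: "p = (i, c, k)" by (cases p)
  have "linear (\<lambda>x::real^4. (x $ i * c) *\<^sub>R bv k - (x $ k / c) *\<^sub>R bv i)"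
    by (intro linearI) (simp_all add: algebra_simps add_divide_distrib)
  then have "linear (\<lambda>x. ((x $ i * c) *\<^sub>R bv k - (x $ k / c) *\<^sub>R bv i) + cs_ext ps x)"
    using Cons by (rule linear_compose_add)
  then show ?case by (simp add: cs_ext_def p)
qed

text \<open>Only the Pfaffian condition is nonlinear; the four closedness and six compatibility
  equations are linear in the coefficients.\<close>

lemma kahler_two_form_iff:
  fixes a b c d e f :: real and g :: solv4
  assumes J: "linear J"
  defines "W \<equiv> two_form a b c d e f" and "B \<equiv> bracket g"
  shows "symplectic_form (bracket g) W \<and> compatible J W \<longleftrightarrow>
    a * f - b * e + c * d \<noteq> 0 \<and>
    W (B (bv 1) (bv 2)) (bv 3) + W (B (bv 2) (bv 3)) (bv 1) + W (B (bv 3) (bv 1)) (bv 2) = 0 \<and>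
    W (B (bv 1) (bv 2)) (bv 4) + W (B (bv 2) (bv 4)) (bv 1) + W (B (bv 4) (bv 1)) (bv 2) = 0 \<and>
    W (B (bv 1) (bv 3)) (bv 4) + W (B (bv 3) (bv 4)) (bv 1) + W (B (bv 4) (bv 1)) (bv 3) = 0 \<and>
    W (B (bv 2) (bv 3)) (bv 4) + W (B (bv 3) (bv 4)) (bv 2) + W (B (bv 4) (bv 2)) (bv 3) = 0 \<and>
    W (J (bv 1)) (J (bv 2)) = a \<and> W (J (bv 1)) (J (bv 3)) = b \<and> W (J (bv 1)) (J (bv 4)) = c \<and>
    W (J (bv 2)) (J (bv 3)) = d \<and> W (J (bv 2)) (J (bv 4)) = e \<and> W (J (bv 3)) (J (bv 4)) = f"
proof -
  have b: "bilinear W" and s: "\<forall>x. W x x = 0"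
    by (simp_all add: W_def bilinear_two_form two_form_self)
  have v: "W (bv 1) (bv 2) = a" "W (bv 1) (bv 3) = b" "W (bv 1) (bv 4) = c"
    "W (bv 2) (bv 3) = d" "W (bv 2) (bv 4) = e" "W (bv 3) (bv 4) = f"
    by (simp_all add: W_def two_form_def ee_def axis_def)
  have n: "(\<forall>x. (\<forall>y. W x y = 0) \<longrightarrow> x = 0) \<longleftrightarrow> a * f - b * e + c * d \<noteq> 0"
    unfolding W_def by (rule two_form_nondegenerate_iff)
  show ?thesis
    unfolding symplectic_form_def compatible_iff_basis[OF b s J] closed_iff_basis[OF b s] n v
    using b s by (auto simp: B_def)
qed

text \<open>Separates two tasks: \<open>P\<close> is the solved system of an item, and matching it
  with the notation of the list is left to the last premise.\<close>

lemma kahler_set_eqI: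
  assumes J: "linear J"
    and "\<And>a b c d e f. symplectic_form (bracket g) (two_form a b c d e f) \<and>
           compatible J (two_form a b c d e f) \<longleftrightarrow> P a b c d e f"
    and "\<Omega> = {two_form a b c d e f | a b c d e f. P a b c d e f}"
  shows "{\<omega>. symplectic_form (bracket g) \<omega> \<and> compatible J \<omega>} = \<Omega>"
proof (intro set_eqI iffI)
  fix \<omega> assume w: "\<omega> \<in> {\<omega>. symplectic_form (bracket g) \<omega> \<and> compatible J \<omega>}"
  then obtain a b c d e f where "\<omega> = two_form a b c d e f"
    unfolding symplectic_form_def using alternating_eq_two_form by blast
  then show "\<omega> \<in> \<Omega>" using w assms(2,3) by blast
next
  fix \<omega> assume "\<omega> \<in> \<Omega>"
  then show "\<omega> \<in> {\<omega>. symplectic_form (bracket g) \<omega> \<and> compatible J \<omega>}"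
    using assms(2,3) by blast
qed

lemmas coord_simps = cs_ext_def bracket_def two_form_def ee_def axis_def vec_eq_iff forall_4

text \<open>On \<open>R4'_gd 0 \<delta>\<close>, closedness couples coefficients in pairs such as a
  = \<delta> b, b = -\<delta> a. Elimination leaves a multiple of 1 + \<delta>^2.\<close>

lemma mult_square_add_self_iff:
  "- (e * \<delta> * \<delta>) = e \<longleftrightarrow> e = (0::real)" "e * \<delta> * \<delta> + e = 0 \<longleftrightarrow> e = (0::real)"
proof -
  have "\<delta> * \<delta> + 1 \<noteq> 0" using zero_le_square[of \<delta>] by linarith
  then have "e * (\<delta> * \<delta> + 1) = 0 \<longleftrightarrow> e = 0" by simp
  then show "- (e * \<delta> * \<delta>) = e \<longleftrightarrow> e = 0" "e * \<delta> * \<delta> + e = 0 \<longleftrightarrow> e = 0"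
    by (auto simp: algebra_simps)
qed

lemma kahler_iff_r4'_0:
  assumes "\<delta> > 0" "J \<in> {cs_ext [(4, 1, 1), (2, 1, 3)], cs_ext [(4, 1, 1), (2, -1, 3)]}"
  shows "symplectic_form (bracket (R4'_gd 0 \<delta>)) (two_form a b c d e f) \<and>
     compatible J (two_form a b c d e f) \<longleftrightarrow> a = 0 \<and> b = 0 \<and> e = 0 \<and> f = 0 \<and> c * d \<noteq> 0"
proof -
  have "J = cs_ext [(4, 1, 1), (2, 1, 3)] \<or> J = cs_ext [(4, 1, 1), (2, -1, 3)]" using assms by simp
  then show ?thesis
    by (elim disjE; simp add: kahler_two_form_iff[OF linear_cs_ext] coord_simps) (use assms(1) in \<open>auto simp: mult_square_add_self_iff\<close>)
qed

lemma kahler_iff_d4_half: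
  assumes "J \<in> {cs_ext [(4, 1, 3), (1, 1, 2)], cs_ext [(4, 1, 3), (1, -1, 2)]}"
  shows "symplectic_form (bracket (D4_lam (1/2))) (two_form a b c d e f) \<and>
     compatible J (two_form a b c d e f) \<longleftrightarrow> b = 0 \<and> c = 0 \<and> d = 0 \<and> e = 0 \<and> f = - a \<and> a \<noteq> 0"
proof -
  have "J = cs_ext [(4, 1, 3), (1, 1, 2)] \<or> J = cs_ext [(4, 1, 3), (1, -1, 2)]" using assms by simp
  then show ?thesis
    by (elim disjE; simp add: kahler_two_form_iff[OF linear_cs_ext] coord_simps) auto
qed
text \<open>On the span of e^13 and e^23 the derivation ad e_4 of \<open>D4'_del \<delta>\<close>
  has eigenvalues 3\<delta>/2 + i and 3\<delta>/2 - i up to sign, never zero; four times their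
  squared modulus is 9\<delta>^2 + 4.\<close>

lemma complex_eigen_zero:
  assumes "\<delta> * (b * 3) = d * 2" "b * 2 + \<delta> * (d * 3) = 0"
  shows "b = 0" "d = (0::real)"
proof -
  have "b * (9 * \<delta>\<^sup>2 + 4) = 0" using assms by algebra
  moreover have "9 * \<delta>\<^sup>2 + 4 \<noteq> 0" using zero_le_power2[of \<delta>] by linarith
  ultimately show "b = 0" by simp
  then show "d = 0" using assms by simp
qed

lemma kahler_iff_d4':
  assumes "\<delta> \<noteq> 0" "J \<in> {cs_ext [(4, 1, 3), (1, 1, 2)], cs_ext [(4, -1, 3), (1, 1, 2)],
         cs_ext [(4, -1, 3), (1, -1, 2)], cs_ext [(4, 1, 3), (1, -1, 2)]}"
  shows "symplectic_form (bracket (D4'_del \<delta>)) (two_form a b c d e f) \<and>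
     compatible J (two_form a b c d e f) \<longleftrightarrow>
     b = 0 \<and> c = 0 \<and> d = 0 \<and> e = 0 \<and> f = - a * \<delta> \<and> a \<noteq> 0" (is "?K \<longleftrightarrow> ?R")
proof -
  have J: "J = cs_ext [(4, 1, 3), (1, 1, 2)] \<or> J = cs_ext [(4, -1, 3), (1, 1, 2)] \<or>
         J = cs_ext [(4, -1, 3), (1, -1, 2)] \<or> J = cs_ext [(4, 1, 3), (1, -1, 2)]" using assms by simp
  \<comment> \<open>The sign s is minus the product of the signs in J e_4 = +-e_3 and J e_1 = +-e_2,
    so one system serves all four structures.\<close>
  have "\<exists>s\<in>{1, -1}. ?K \<longleftrightarrow> a * f - b * e + c * d \<noteq> 0 \<and> \<delta> * a + f = 0 \<and> \<delta> * (b * 3) = d * 2 \<and>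
      b * 2 + \<delta> * (d * 3) = 0 \<and> s * e = b \<and> - s * d = c \<and> - s * c = d \<and> s * b = e"
    using J
    by (elim disjE; simp add: kahler_two_form_iff[OF linear_cs_ext] coord_simps; simp add: field_simps)
  then obtain s where K: "?K \<longleftrightarrow> a * f - b * e + c * d \<noteq> 0 \<and> \<delta> * a + f = 0 \<and> \<delta> * (b * 3) = d * 2 \<and>
      b * 2 + \<delta> * (d * 3) = 0 \<and> s * e = b \<and> - s * d = c \<and> - s * c = d \<and> s * b = e"
    by blast
  show ?thesis
    unfolding K
  proof
    assume L: "a * f - b * e + c * d \<noteq> 0 \<and> \<delta> * a + f = 0 \<and> \<delta> * (b * 3) = d * 2 \<and>
      b * 2 + \<delta> * (d * 3) = 0 \<and> s * e = b \<and> - s * d = c \<and> - s * c = d \<and> s * b = e"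
    then have "b = 0" "d = 0" using complex_eigen_zero[of \<delta> b d] by blast+
    with L show ?R by (auto simp: algebra_simps eq_neg_iff_add_eq_0)
  qed (use assms(1) in auto)
qed

text \<open>In the items whose condition involves two coefficients jointly, the Pfaffian becomes, up
  to sign, the sum of their squares.\<close>

lemma neg_square_eq_square_iff: "- (b * b) = c * c \<longleftrightarrow> b = 0 \<and> c = (0::real)"
  using sum_squares_eq_zero_iff[of b c] by linarith

lemma kahler_list_sound:
  assumes "kahler_list g J \<Omega>"
  shows "valid_params g \<and> complex_structure (bracket g) J \<and>
    {\<omega>. symplectic_form (bracket g) \<omega> \<and> compatible J \<omega>} = \<Omega>"
  using assms
proof (cases rule: kahler_list.cases)
  case rr3_0
  have "complex_structure (bracket g) J"
    using rr3_0 by (auto simp: complex_structure_def linear_cs_ext coord_simps algebra_simps)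
  moreover have "{\<omega>. symplectic_form (bracket g) \<omega> \<and> compatible J \<omega>} = \<Omega>"
    unfolding rr3_0(1,2,3)
    by (rule kahler_set_eqI[OF linear_cs_ext, where
        P = "\<lambda>a b c d e f. b = 0 \<and> c = 0 \<and> d = 0 \<and> e = 0 \<and> a * f \<noteq> 0"],
      subst kahler_two_form_iff[OF linear_cs_ext], simp add: coord_simps,
      auto simp: neg_square_eq_square_iff)
      (auto simp: two_form_def[abs_def] algebra_simps)
  ultimately show ?thesis using rr3_0 by simp
next
  case rh3
  have "complex_structure (bracket g) J"
    using rh3 by (auto simp: complex_structure_def linear_cs_ext coord_simps algebra_simps)
  moreover have "{\<omega>. symplectic_form (bracket g) \<omega> \<and> compatible J \<omega>} = \<Omega>"
    unfolding rh3(1,2,3)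
    by (rule kahler_set_eqI[OF linear_cs_ext, where
        P = "\<lambda>a b c d e f. d = - c \<and> e = b \<and> f = 0 \<and> (b \<noteq> 0 \<or> c \<noteq> 0)"],
      subst kahler_two_form_iff[OF linear_cs_ext], simp add: coord_simps,
      auto simp: neg_square_eq_square_iff)
      (auto simp: two_form_def[abs_def] algebra_simps)
  ultimately show ?thesis using rh3 by simp
next
  case rr3'_0
  have "complex_structure (bracket g) J"
    using rr3'_0 by (auto simp: complex_structure_def linear_cs_ext coord_simps algebra_simps)
  moreover have "{\<omega>. symplectic_form (bracket g) \<omega> \<and> compatible J \<omega>} = \<Omega>"
    unfolding rr3'_0(1,2,3)
    by (rule kahler_set_eqI[OF linear_cs_ext, where
        P = "\<lambda>a b c d e f. a = 0 \<and> b = 0 \<and> e = 0 \<and> f = 0 \<and> c * d \<noteq> 0"],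
      subst kahler_two_form_iff[OF linear_cs_ext], simp add: coord_simps,
      auto simp: neg_square_eq_square_iff)
      (auto simp: two_form_def[abs_def] algebra_simps)
  ultimately show ?thesis using rr3'_0 by simp
next
  case r2r2
  have "complex_structure (bracket g) J"
    using r2r2 by (auto simp: complex_structure_def linear_cs_ext coord_simps algebra_simps)
  moreover have "{\<omega>. symplectic_form (bracket g) \<omega> \<and> compatible J \<omega>} = \<Omega>"
    unfolding r2r2(1,2,3)
    by (rule kahler_set_eqI[OF linear_cs_ext, where
        P = "\<lambda>a b c d e f. b = 0 \<and> c = 0 \<and> d = 0 \<and> e = 0 \<and> a * f \<noteq> 0"],
      subst kahler_two_form_iff[OF linear_cs_ext], simp add: coord_simps,
      auto simp: neg_square_eq_square_iff)
      (auto simp: two_form_def[abs_def] algebra_simps)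
  ultimately show ?thesis using r2r2 by simp
next
  case r2'_a
  have "complex_structure (bracket g) J"
    using r2'_a by (auto simp: complex_structure_def linear_cs_ext coord_simps algebra_simps)
  moreover have "{\<omega>. symplectic_form (bracket g) \<omega> \<and> compatible J \<omega>} = \<Omega>"
    unfolding r2'_a(1,2,3)
    by (rule kahler_set_eqI[OF linear_cs_ext, where
        P = "\<lambda>a b c d e f. a = 0 \<and> d = c \<and> e = - b \<and> f = 0 \<and> (b \<noteq> 0 \<or> c \<noteq> 0)"],
      subst kahler_two_form_iff[OF linear_cs_ext], simp add: coord_simps,
      auto simp: neg_square_eq_square_iff)
      (auto simp: two_form_def[abs_def] algebra_simps)
  ultimately show ?thesis using r2'_a by simp
next
  case r2'_b
  have "complex_structure (bracket g) J"
    using r2'_b by (auto simp: complex_structure_def linear_cs_ext coord_simps algebra_simps)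
  moreover have "{\<omega>. symplectic_form (bracket g) \<omega> \<and> compatible J \<omega>} = \<Omega>"
    unfolding r2'_b(1,2,3)
    by (rule kahler_set_eqI[OF linear_cs_ext, where
        P = "\<lambda>a b c d e f. d = c \<and> e = - b \<and> f = 0 \<and> (b \<noteq> 0 \<or> c \<noteq> 0)"],
      subst kahler_two_form_iff[OF linear_cs_ext], simp add: coord_simps,
      auto simp: neg_square_eq_square_iff)
      (auto simp: two_form_def[abs_def] algebra_simps)
  ultimately show ?thesis using r2'_b by simp
next
  case r4_m1_m1
  have "complex_structure (bracket g) J"
    using r4_m1_m1 by (auto simp: complex_structure_def linear_cs_ext coord_simps algebra_simps)
  moreover have "{\<omega>. symplectic_form (bracket g) \<omega> \<and> compatible J \<omega>} = \<Omega>"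
    unfolding r4_m1_m1(1,2,3)
    by (rule kahler_set_eqI[OF linear_cs_ext, where
        P = "\<lambda>a b c d e f. d = 0 \<and> e = - b \<and> f = a \<and> (a \<noteq> 0 \<or> b \<noteq> 0)"],
      subst kahler_two_form_iff[OF linear_cs_ext], simp add: coord_simps,
      auto simp: neg_square_eq_square_iff)
      (auto simp: two_form_def[abs_def] algebra_simps)
  ultimately show ?thesis using r4_m1_m1 by simp
next
  case r4_m1_p1
  have "complex_structure (bracket g) J"
    using r4_m1_p1 by (auto simp: complex_structure_def linear_cs_ext coord_simps algebra_simps)
  \<comment> \<open>Closedness on e_1, e_3, e_4 reads 2b = 0, because e_4 has eigenvalue 1 on both
    e_1 and e_3. On e_2 and e_3 the eigenvalues cancel, which leaves d free; compatibility ties it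
    to c.\<close>
  moreover have "{\<omega>. symplectic_form (bracket g) \<omega> \<and> compatible J \<omega>} = \<Omega>"
    unfolding r4_m1_p1(1,2,3)
    by (rule kahler_set_eqI[OF linear_cs_ext, where
        P = "\<lambda>a b c d e f. b = 0 \<and> d = - c \<and> f = - a \<and> (a \<noteq> 0 \<or> c \<noteq> 0)"],
      subst kahler_two_form_iff[OF linear_cs_ext], simp add: coord_simps,
      auto simp: neg_square_eq_square_iff)
      (auto simp: two_form_def[abs_def] algebra_simps)
  ultimately show ?thesis using r4_m1_p1 by simp
next
  case (r4'_0 \<delta>)
  obtain ps where J: "J = cs_ext ps" using r4'_0 by auto
  have "complex_structure (bracket g) J"
    using r4'_0 by (auto simp: complex_structure_def linear_cs_ext coord_simps algebra_simps)
  moreover have "{\<omega>. symplectic_form (bracket g) \<omega> \<and> compatible J \<omega>} = \<Omega>"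
    unfolding r4'_0(1,2)
    by (rule kahler_set_eqI[OF _ kahler_iff_r4'_0])
      (use r4'_0 in \<open>auto simp: linear_cs_ext two_form_def[abs_def] algebra_simps\<close>)
  ultimately show ?thesis using r4'_0 by simp
next
  case d4_1
  have "complex_structure (bracket g) J"
    using d4_1 by (auto simp: complex_structure_def linear_cs_ext coord_simps algebra_simps)
  moreover have "{\<omega>. symplectic_form (bracket g) \<omega> \<and> compatible J \<omega>} = \<Omega>"
    unfolding d4_1(1,2,3)
    by (rule kahler_set_eqI[OF linear_cs_ext, where
        P = "\<lambda>a b c d e f. b = 0 \<and> d = 0 \<and> e = 0 \<and> f = - a \<and> a \<noteq> 0"],
      subst kahler_two_form_iff[OF linear_cs_ext], simp add: coord_simps,
      auto simp: neg_square_eq_square_iff)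
      (auto simp: two_form_def[abs_def] algebra_simps)
  ultimately show ?thesis using d4_1 by simp
next
  case d4_2_a
  have "complex_structure (bracket g) J"
    using d4_2_a by (auto simp: complex_structure_def linear_cs_ext coord_simps algebra_simps)
  moreover have "{\<omega>. symplectic_form (bracket g) \<omega> \<and> compatible J \<omega>} = \<Omega>"
    unfolding d4_2_a(1,2,3)
    by (rule kahler_set_eqI[OF linear_cs_ext, where
        P = "\<lambda>a b c d e f. a = 0 \<and> b = 0 \<and> d = c \<and> f = 0 \<and> c \<noteq> 0"],
      subst kahler_two_form_iff[OF linear_cs_ext], simp add: coord_simps,
      auto simp: neg_square_eq_square_iff)
      (auto simp: two_form_def[abs_def] algebra_simps)
  ultimately show ?thesis using d4_2_a by simp
next
  case d4_2_b
  have "complex_structure (bracket g) J"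
    using d4_2_b by (auto simp: complex_structure_def linear_cs_ext coord_simps algebra_simps)
  moreover have "{\<omega>. symplectic_form (bracket g) \<omega> \<and> compatible J \<omega>} = \<Omega>"
    unfolding d4_2_b(1,2,3)
    by (rule kahler_set_eqI[OF linear_cs_ext, where
        P = "\<lambda>a b c d e f. a = 0 \<and> b = 0 \<and> e = 0 \<and> f = 0 \<and> c * d \<noteq> 0"],
      subst kahler_two_form_iff[OF linear_cs_ext], simp add: coord_simps,
      auto simp: neg_square_eq_square_iff)
      (auto simp: two_form_def[abs_def] algebra_simps)
  ultimately show ?thesis using d4_2_b by simp
next
  case d4_half
  obtain ps where J: "J = cs_ext ps" using d4_half by auto
  have "complex_structure (bracket g) J"
    using d4_half by (auto simp: complex_structure_def linear_cs_ext coord_simps algebra_simps)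
  moreover have "{\<omega>. symplectic_form (bracket g) \<omega> \<and> compatible J \<omega>} = \<Omega>"
    unfolding d4_half(1,2)
    by (rule kahler_set_eqI[OF _ kahler_iff_d4_half])
      (use d4_half in \<open>auto simp: linear_cs_ext two_form_def[abs_def] algebra_simps\<close>)
  ultimately show ?thesis using d4_half by simp
next
  case (d4' \<delta>)
  obtain ps where J: "J = cs_ext ps" using d4' by auto
  have "complex_structure (bracket g) J"
    using d4' by (auto simp: complex_structure_def linear_cs_ext coord_simps algebra_simps)
  moreover have "{\<omega>. symplectic_form (bracket g) \<omega> \<and> compatible J \<omega>} = \<Omega>"
    unfolding d4'(1,2)
    by (rule kahler_set_eqI[OF _ kahler_iff_d4'])
      (use d4' in \<open>auto simp: linear_cs_ext two_form_def[abs_def] algebra_simps\<close>)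
  ultimately show ?thesis using d4' by simp
qed

section \<open>Adapted frames\<close>

definition frame :: "real^4 \<Rightarrow> real^4 \<Rightarrow> real^4 \<Rightarrow> real^4 \<Rightarrow> real^4 \<Rightarrow> real^4" where
  "frame u1 u2 u3 u4 x = x$1 *\<^sub>R u1 + x$2 *\<^sub>R u2 + x$3 *\<^sub>R u3 + x$4 *\<^sub>R u4"

text \<open>Stated for a quadruple rather than a set, so that a repeated vector counts as a
  dependence.\<close>

definition independent4 :: "real^4 \<Rightarrow> real^4 \<Rightarrow> real^4 \<Rightarrow> real^4 \<Rightarrow> bool" where
  "independent4 u1 u2 u3 u4 \<longleftrightarrow> (\<forall>a b c d.
     a *\<^sub>R u1 + b *\<^sub>R u2 + c *\<^sub>R u3 + d *\<^sub>R u4 = 0 \<longrightarrow> a = 0 \<and> b = 0 \<and> c = 0 \<and> d = 0)"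

lemma linear_frame: "linear (frame u1 u2 u3 u4)"
  by (auto intro!: linearI simp: frame_def algebra_simps)

lemma frame_bv: "frame u1 u2 u3 u4 (bv 1) = u1" "frame u1 u2 u3 u4 (bv 2) = u2"
  "frame u1 u2 u3 u4 (bv 3) = u3" "frame u1 u2 u3 u4 (bv 4) = u4"
  by (simp_all add: frame_def axis_def)

lemma bij_frame:
  assumes "independent4 u1 u2 u3 u4"
  shows "bij (frame u1 u2 u3 u4)"
proof -
  have "inj (frame u1 u2 u3 u4)"
    unfolding linear_injective_0[OF linear_frame]
  proof (intro allI impI)
    fix x assume "frame u1 u2 u3 u4 x = 0"
    then have "x$1 = 0 \<and> x$2 = 0 \<and> x$3 = 0 \<and> x$4 = 0"
      using assms unfolding independent4_def frame_def by blast
    then show "x = 0" by (simp add: vec_eq_iff forall_4)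
  qed
  then show ?thesis
    using linear_injective_imp_surjective[OF linear_frame] by (simp add: bij_def)
qed

lemma independent4_expand:
  assumes "independent4 u1 u2 u3 u4"
  obtains a b c d where "x = a *\<^sub>R u1 + b *\<^sub>R u2 + c *\<^sub>R u3 + d *\<^sub>R u4"
proof -
  have "surj (frame u1 u2 u3 u4)" using bij_frame[OF assms] by (simp add: bij_def)
  then obtain y where "x = frame u1 u2 u3 u4 y" by blast
  then show ?thesis using that unfolding frame_def by blast
qed

lemma linear_eq_on_bv:
  fixes f h :: "real^4 \<Rightarrow> real^4"
  assumes f: "linear f" and h: "linear h"
    and "f (bv 1) = h (bv 1)" "f (bv 2) = h (bv 2)" "f (bv 3) = h (bv 3)" "f (bv 4) = h (bv 4)"
  shows "f x = h x"
proof -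
  have "f (x$1 *\<^sub>R bv 1 + x$2 *\<^sub>R bv 2 + x$3 *\<^sub>R bv 3 + x$4 *\<^sub>R bv 4) =
    h (x$1 *\<^sub>R bv 1 + x$2 *\<^sub>R bv 2 + x$3 *\<^sub>R bv 3 + x$4 *\<^sub>R bv 4)"
    using assms(3-)
    by (simp only: linear_add[OF f] linear_scale[OF f] linear_add[OF h] linear_scale[OF h])
  then show ?thesis using vec4_expand[of x] by simp
qed

text \<open>Each component of F[x, y] - [Fx, Fy] is an alternating form, hence vanishes once it does
  so on six pairs.\<close>

lemma bracket_frame:
  fixes u1 u2 u3 u4 :: "real^4" and g :: solv4
  defines "F \<equiv> frame u1 u2 u3 u4" and "B \<equiv> bracket g"
  assumes "B u1 u2 = F (B (bv 1) (bv 2))" "B u1 u3 = F (B (bv 1) (bv 3))"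
    "B u1 u4 = F (B (bv 1) (bv 4))" "B u2 u3 = F (B (bv 2) (bv 3))"
    "B u2 u4 = F (B (bv 2) (bv 4))" "B u3 u4 = F (B (bv 3) (bv 4))"
  shows "F (B x y) = B (F x) (F y)"
proof -
  note bl = bilinear_ladd[OF bilinear_bracket] bilinear_radd[OF bilinear_bracket]
    bilinear_lmul[OF bilinear_bracket] bilinear_rmul[OF bilinear_bracket]
  have F: "linear F" by (simp add: F_def linear_frame)
  note lF = linear_add[OF F] linear_scale[OF F]
  define \<omega> where "\<omega> k x y = (F (B x y) - B (F x) (F y)) $ k" for k x y
  have "\<omega> k x y = 0" for k
  proof (rule alternating_eq_0[of "\<omega> k"])
    show "bilinear (\<omega> k)"
      unfolding bilinear_def \<omega>_def B_def by (auto intro!: linearI simp: bl lF algebra_simps)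
    show "\<forall>x. \<omega> k x x = 0"
      by (simp add: \<omega>_def B_def bracket_alternating linear_0[OF F])
  qed (use assms(3-) in \<open>simp_all add: \<omega>_def F_def frame_bv\<close>)
  then show ?thesis by (simp add: \<omega>_def vec_eq_iff)
qed

text \<open>The frame map F is an automorphism of g with J F = F J', because both properties need
  checking on basis vectors only.\<close>

lemma equivalent_csI:
  fixes u1 u2 u3 u4 :: "real^4" and g :: solv4
  defines "F \<equiv> frame u1 u2 u3 u4" and "B \<equiv> bracket g"
  assumes J: "linear J" and J': "linear J'" and ind: "independent4 u1 u2 u3 u4"
    and br: "B u1 u2 = F (B (bv 1) (bv 2))" "B u1 u3 = F (B (bv 1) (bv 3))"
    "B u1 u4 = F (B (bv 1) (bv 4))" "B u2 u3 = F (B (bv 2) (bv 3))"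
    "B u2 u4 = F (B (bv 2) (bv 4))" "B u3 u4 = F (B (bv 3) (bv 4))"
    and Ju: "J u1 = F (J' (bv 1))" "J u2 = F (J' (bv 2))" "J u3 = F (J' (bv 3))" "J u4 = F (J' (bv 4))"
  shows "equivalent_cs B J J'"
proof -
  have F: "linear F" and bij: "bij F" by (simp_all add: F_def linear_frame bij_frame ind)
  have FB: "F (B x y) = B (F x) (F y)" for x y
    using bracket_frame[of g u1 u2 u3 u4] br unfolding F_def B_def by blast
  have JF: "(J \<circ> F) x = (F \<circ> J') x" for x
    by (rule linear_eq_on_bv[OF linear_compose[OF F J] linear_compose[OF J' F]])
      (use Ju in \<open>simp_all add: F_def frame_bv\<close>)
  \<comment> \<open>Equivalence asks for a map from J to J', while F goes the other way; its inverse
    is taken.\<close>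
  define h where "h = inv F"
  have hF: "h (F x) = x" and Fh: "F (h x) = x" for x
    using bij by (simp_all add: h_def bij_def surj_f_inv_f)
  have "linear h"
  proof (rule linearI)
    show "h (x + y) = h x + h y" for x y
      using hF[of "h x + h y"] by (simp add: linear_add[OF F] Fh)
    show "h (c *\<^sub>R x) = c *\<^sub>R h x" for c x
      using hF[of "c *\<^sub>R h x"] by (simp add: linear_scale[OF F] Fh)
  qed
  moreover have "bij h" using bij by (simp add: h_def bij_imp_bij_inv)
  moreover have "h (B x y) = B (h x) (h y)" for x y
    using hF[of "B (h x) (h y)"] by (simp add: FB Fh)
  moreover have "h \<circ> J = J' \<circ> h"
  proof
    fix x
    have "F (J' (h x)) = J x" using JF[of "h x"] by (simp add: Fh)
    then show "(h \<circ> J) x = (J' \<circ> h) x" using hF[of "J' (h x)"] by simp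
  qed
  ultimately show ?thesis unfolding equivalent_cs_def lie_automorphism_def by blast
qed

text \<open>The k-th coordinate of the relation kills the coefficient of X, that of its image under
  J the coefficient of JX. On the rest, c + dJ is invertible unless c = d = 0.\<close>

lemma adapted_independent:
  fixes J :: "real^4 \<Rightarrow> real^4"
  assumes J: "linear J" and J2: "\<And>x. J (J x) = - x"
    and X: "X $ k = 1" "J X $ k = 0" and v: "v \<noteq> 0" "v $ k = 0" "J v $ k = 0"
  shows "independent4 X (J X) v (J v)"
  unfolding independent4_def
proof (intro allI impI)
  fix a b c d
  assume z: "a *\<^sub>R X + b *\<^sub>R J X + c *\<^sub>R v + d *\<^sub>R J v = 0"
  have "(a *\<^sub>R X + b *\<^sub>R J X + c *\<^sub>R v + d *\<^sub>R J v) $ k = 0" using z by simp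
  then have a: "a = 0" using X v by simp
  have z': "J (a *\<^sub>R X + b *\<^sub>R J X + c *\<^sub>R v + d *\<^sub>R J v) = 0" by (simp add: z linear_0[OF J])
  then have z'': "a *\<^sub>R J X - b *\<^sub>R X + c *\<^sub>R J v - d *\<^sub>R v = 0"
    by (simp add: linear_add[OF J] linear_scale[OF J] J2)
  then have "(a *\<^sub>R J X - b *\<^sub>R X + c *\<^sub>R J v - d *\<^sub>R v) $ k = 0" by simp
  then have b: "b = 0" using X v by simp
  \<comment> \<open>Multiplication of (c + dJ)v = 0 by the conjugate c - dJ.\<close>
  have "c *\<^sub>R (c *\<^sub>R v + d *\<^sub>R J v) - d *\<^sub>R (c *\<^sub>R J v - d *\<^sub>R v) = 0"
    using z z'' a b by simp
  then have "(c * c + d * d) *\<^sub>R v = 0" by (simp add: algebra_simps)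
  then have "c * c + d * d = 0" using v by simp
  then show "a = 0 \<and> b = 0 \<and> c = 0 \<and> d = 0" using a b by (simp add: sum_squares_eq_zero_iff)
qed

lemma adapted_exists:
  fixes J :: "real^4 \<Rightarrow> real^4"
  assumes J: "linear J" and J2: "\<And>x. J (J x) = - x"
  obtains X v where "X $ k = 1" "J X $ k = 0" "v \<noteq> 0" "v $ k = 0" "J v $ k = 0"
proof -
  note lJ = linear_add[OF J] linear_scale[OF J] linear_diff[OF J] J2
  \<comment> \<open>With X = x e_k + y J e_k the two conditions read x + cy = 1 and cx - y = 0;
    hence y = cx and x = 1/(1 + c^2).\<close>
  define c where "c = J (bv k) $ k"
  define X where "X = (1 / (1 + c * c)) *\<^sub>R (bv k + c *\<^sub>R J (bv k))"
  have c0: "1 + c * c \<noteq> 0" using zero_le_square[of c] by linarith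
  have X: "X $ k = 1" "J X $ k = 0"
    using c0 by (simp_all add: X_def lJ c_def[symmetric])
  \<comment> \<open>This is the projection of y along X and JX onto the vectors u for which u and Ju
    have k-th coordinate 0. It cannot vanish identically, since two vectors do not span the
    space.\<close>
  have "\<exists>y. y - y$k *\<^sub>R X + J y $ k *\<^sub>R J X \<noteq> 0"
  proof (rule ccontr)
    assume no: "\<not> ?thesis"
    have *: "y = y$k *\<^sub>R X - J y $ k *\<^sub>R J X" for y
    proof -
      have "y - y$k *\<^sub>R X + J y $ k *\<^sub>R J X = 0" using no by blast
      then show ?thesis by (simp add: eq_diff_eq) (simp add: algebra_simps)
    qed
    have "y \<in> span {X, J X}" for y
      by (subst *[of y]) (intro span_diff span_scale span_base; simp)
    then have "dim (UNIV :: (real^4) set) \<le> card {X, J X}"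
      by (intro dim_le_card) auto
    also have "\<dots> \<le> 2" by (simp add: card_insert_if)
    finally show False by simp
  qed
  then obtain y where y: "y - y$k *\<^sub>R X + J y $ k *\<^sub>R J X \<noteq> 0" by blast
  show ?thesis
    using that[OF X y] by (simp add: lJ X)
qed

text \<open>With h the kernel of e^k, the vectors v and Jv span the J-invariant plane h \<inter> Jh,
  and JX completes them to a basis of h.\<close>

definition adapted :: "(real^4 \<Rightarrow> real^4) \<Rightarrow> 4 \<Rightarrow> real^4 \<Rightarrow> real^4 \<Rightarrow> bool" where
  "adapted J k X v \<longleftrightarrow> X $ k = 1 \<and> J X $ k = 0 \<and> v \<noteq> 0 \<and> v $ k = 0 \<and> J v $ k = 0"

section \<open>A complex structure with a compatible symplectic form\<close>

locale pseudo_kahler =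
  fixes g :: solv4 and J :: "real^4 \<Rightarrow> real^4" and \<omega> :: "real^4 \<Rightarrow> real^4 \<Rightarrow> real"
  assumes complex: "complex_structure (bracket g) J"
    and symplectic: "symplectic_form (bracket g) \<omega>"
    and compatible: "compatible J \<omega>"
begin

lemma linear_J: "linear J" and J_J: "J (J x) = - x"
  using complex by (simp_all add: complex_structure_def)

lemmas J_simps = linear_add[OF linear_J] linear_diff[OF linear_J] linear_scale[OF linear_J]
  linear_neg[OF linear_J] linear_0[OF linear_J] J_J

lemma nijenhuis: "bracket g (J x) (J y) = bracket g x y + J (bracket g (J x) y) + J (bracket g x (J y))"
proof -
  have "bracket g (J x) (J y) - bracket g x y - J (bracket g (J x) y) - J (bracket g x (J y)) = 0"
    using complex unfolding complex_structure_def by blast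
  then show ?thesis by (simp add: diff_diff_eq)
qed

lemma bilinear_\<omega>: "bilinear \<omega>" and \<omega>_self: "\<omega> x x = 0"
  using symplectic by (simp_all add: symplectic_form_def)

lemmas \<omega>_simps = bilinear_ladd[OF bilinear_\<omega>] bilinear_radd[OF bilinear_\<omega>]
  bilinear_lmul[OF bilinear_\<omega>] bilinear_rmul[OF bilinear_\<omega>]
  bilinear_lneg[OF bilinear_\<omega>] bilinear_rneg[OF bilinear_\<omega>]
  bilinear_lzero[OF bilinear_\<omega>] bilinear_rzero[OF bilinear_\<omega>]
  bilinear_lsub[OF bilinear_\<omega>] bilinear_rsub[OF bilinear_\<omega>] \<omega>_self

lemmas bracket_simps = bilinear_ladd[OF bilinear_bracket] bilinear_radd[OF bilinear_bracket]
  bilinear_lmul[OF bilinear_bracket] bilinear_rmul[OF bilinear_bracket]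
  bilinear_lneg[OF bilinear_bracket] bilinear_rneg[OF bilinear_bracket]
  bilinear_lzero[OF bilinear_bracket] bilinear_rzero[OF bilinear_bracket]
  bilinear_lsub[OF bilinear_bracket] bilinear_rsub[OF bilinear_bracket] bracket_alternating

lemma \<omega>_swap: "\<omega> x y = - \<omega> y x"
  using alternating_swap[OF bilinear_\<omega>] \<omega>_self by blast

lemma \<omega>_J: "\<omega> (J x) (J y) = \<omega> x y"
  using compatible by (simp add: compatible_def)

lemma \<omega>_J_left: "\<omega> (J x) y = - \<omega> x (J y)"
  using \<omega>_J[of "J x" y] by (simp add: J_J \<omega>_simps)

lemma closed: "\<omega> (bracket g x y) z + \<omega> (bracket g y z) x + \<omega> (bracket g z x) y = 0"
  using symplectic by (simp add: symplectic_form_def)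

lemma nondegenerate: "(\<And>y. \<omega> x y = 0) \<Longrightarrow> x = 0"
  using symplectic by (simp add: symplectic_form_def)

lemma adapted_independent4: "adapted J k X v \<Longrightarrow> independent4 X (J X) v (J v)"
  unfolding adapted_def by (intro adapted_independent[OF linear_J J_J]) auto

lemma obtain_adapted: obtains X v where "adapted J k X v"
  using adapted_exists[OF linear_J J_J] unfolding adapted_def by metis

text \<open>X is determined exactly up to vectors of h \<inter> Jh; the normal forms are reached by
  using up this freedom.\<close>

lemma adapted_shift:
  assumes "adapted J k X v"
  shows "adapted J k (X + s *\<^sub>R v + t *\<^sub>R J v) v"
  using assms by (simp add: adapted_def J_simps)

lemma adapted_change:
  assumes "adapted J k X v" "u \<noteq> 0" "u $ k = 0" "J u $ k = 0"
  shows "adapted J k X u"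
  using assms by (simp add: adapted_def)

lemma adapted_plane:
  assumes ad: "adapted J k X v" and u: "u $ k = 0" "J u $ k = 0"
  obtains p q where "u = p *\<^sub>R v + q *\<^sub>R J v"
proof -
  obtain a b c d where e: "u = a *\<^sub>R X + b *\<^sub>R J X + c *\<^sub>R v + d *\<^sub>R J v"
    using independent4_expand[OF adapted_independent4[OF ad]] .
  have "a = 0" using e u(1) ad by (simp add: adapted_def)
  moreover have "b = 0" using e u(2) ad by (simp add: adapted_def J_simps)
  ultimately show ?thesis using e that by simp
qed

lemma adapted_hyperplane:
  assumes ad: "adapted J k X v" and u: "u $ k = 0"
  obtains r p q where "u = r *\<^sub>R J X + p *\<^sub>R v + q *\<^sub>R J v"
proof -
  obtain a b c d where e: "u = a *\<^sub>R X + b *\<^sub>R J X + c *\<^sub>R v + d *\<^sub>R J v"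
    using independent4_expand[OF adapted_independent4[OF ad]] .
  have "a = 0" using e u(1) ad by (simp add: adapted_def)
  then show ?thesis using e that by simp
qed

lemma \<omega>_zero_adapted:
  assumes ad: "adapted J k X v" and "\<omega> u X = 0" "\<omega> u (J X) = 0" "\<omega> u v = 0" "\<omega> u (J v) = 0"
  shows "u = 0"
proof (rule nondegenerate)
  fix y
  obtain a b c d where "y = a *\<^sub>R X + b *\<^sub>R J X + c *\<^sub>R v + d *\<^sub>R J v"
    using independent4_expand[OF adapted_independent4[OF ad]] .
  then show "\<omega> u y = 0" using assms(2-) by (simp add: \<omega>_simps)
qed

end

section \<open>Almost abelian algebras\<close>

text \<open>Whenever X has k-th coordinate 1 and u lies in h, the kernel of e^k, [X, u] = A u, and h
  is abelian. All structure is thus in A restricted to h, whichever X is chosen.\<close>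

locale almost_abelian = pseudo_kahler +
  fixes k :: 4 and A :: "real^4 \<Rightarrow> real^4"
  assumes linear_A: "linear A" and A_k: "A y $ k = 0"
    and bracket_A: "bracket g x y = x $ k *\<^sub>R A y - y $ k *\<^sub>R A x"
begin

lemmas A_simps = linear_add[OF linear_A] linear_diff[OF linear_A] linear_scale[OF linear_A]
  linear_neg[OF linear_A] linear_0[OF linear_A]

text \<open>Integrability for X and u: the brackets of JX with u and Ju vanish inside the abelian
  ideal, which leaves 0 = Au + JAJu.\<close>

lemma A_J_commute:
  assumes "adapted J k X v" "u $ k = 0" "J u $ k = 0"
  shows "A (J u) = J (A u)"
proof -
  have "0 = A u + J (A (J u))"
    using nijenhuis[of X u] assms by (simp add: bracket_A adapted_def J_simps)
  then have "J 0 = J (A u + J (A (J u)))" by simp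
  then show ?thesis by (simp add: J_simps)
qed

text \<open>On the J-invariant plane A acts as the complex number p + iq, and closedness on X, v, Jv
  gives p \<omega>(v, Jv) = 0. The isotypic shape arises when the plane is nondegenerate; an
  isotropic plane leads to the reflection and nilpotent shapes, or to A = 0 on h.\<close>

lemma adapted_normal_form:
  obtains
    (isotypic) a q X v where "adapted J k X v" "A (J X) = a *\<^sub>R J X" "A v = q *\<^sub>R J v" "A (J v) = - q *\<^sub>R v"
  | (reflection) p X v where "adapted J k X v" "p \<noteq> 0" "A (J X) = - p *\<^sub>R J X" "A v = p *\<^sub>R v" "A (J v) = p *\<^sub>R J v"
  | (nilpotent) X v where "adapted J k X v" "A (J X) = v" "A v = 0" "A (J v) = 0"
proof -
  obtain X v where ad: "adapted J k X v" using obtain_adapted .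
  have vk: "v $ k = 0" "J v $ k = 0" "X $ k = 1" "J X $ k = 0" using ad by (simp_all add: adapted_def)
  have AJv: "A (J v) = J (A v)" using A_J_commute[OF ad vk(1,2)] .
  have "J (A v) $ k = 0" using AJv A_k[of "J v"] by simp
  then obtain p q where Av: "A v = p *\<^sub>R v + q *\<^sub>R J v"
    using adapted_plane[OF ad A_k[of v]] by blast
  have AJv: "A (J v) = p *\<^sub>R J v - q *\<^sub>R v" by (simp add: AJv Av J_simps)
  obtain a r s where AY: "A (J X) = a *\<^sub>R J X + r *\<^sub>R v + s *\<^sub>R J v"
    using adapted_hyperplane[OF ad A_k] .
  define m where "m = \<omega> v (J v)"
  have m': "\<omega> (J v) v = - m" by (simp add: m_def \<omega>_swap[of "J v" v])
  have pm: "p * m = 0"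
    using closed[of X v "J v"]
    by (auto simp: bracket_A vk Av AJv \<omega>_simps A_simps m_def[symmetric] m')
  show ?thesis
  proof (cases "m = 0")
    case False
    then have p: "p = 0" using pm by simp
    \<comment> \<open>The coefficients make X' orthogonal to v and Jv; JX' is then orthogonal too,
      because the plane is J-invariant.\<close>
    define X' where "X' = X + (- \<omega> X (J v) / m) *\<^sub>R v + (\<omega> X v / m) *\<^sub>R J v"
    have ad': "adapted J k X' v" unfolding X'_def by (rule adapted_shift[OF ad])
    have X'k: "X' $ k = 1" "J X' $ k = 0" using ad' by (simp_all add: adapted_def)
    have o1: "\<omega> X' v = 0" "\<omega> X' (J v) = 0"
      using False by (simp_all add: X'_def \<omega>_simps m' m_def[symmetric])
    then have o2: "\<omega> (J X') v = 0" "\<omega> (J X') (J v) = 0"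
      by (simp_all add: \<omega>_J_left J_simps \<omega>_simps)
    obtain a r s where AY: "A (J X') = a *\<^sub>R J X' + r *\<^sub>R v + s *\<^sub>R J v"
      using adapted_hyperplane[OF ad' A_k] .
    note sw = \<omega>_swap[of v "J X'"] \<omega>_swap[of "J v" "J X'"]
    have "s = 0"
      using closed[of X' "J X'" v] False
      by (simp add: bracket_A vk X'k AY Av AJv p \<omega>_simps A_simps m_def[symmetric] m' o1 o2 sw)
    moreover have "r = 0"
      using closed[of X' "J X'" "J v"] False
      by (simp add: bracket_A vk X'k AY Av AJv p \<omega>_simps A_simps m_def[symmetric] m' o1 o2 sw)
    ultimately show ?thesis
      using isotypic[OF ad', of a q] AY Av AJv p by simp
  next
    case True
    \<comment> \<open>For an isotropic plane, b + ic is the pairing of v with JX and X; it is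
      nonzero, since otherwise v would be in the kernel of \<omega>. Closedness says (a + p - iq)(b
      + ic) = 0.\<close>
    define b c where "b = \<omega> (J X) v" and "c = \<omega> (J X) (J v)"
    note sw = \<omega>_swap[of v "J X"] \<omega>_swap[of "J v" "J X"]
    have "(a + p) * b + q * c = 0"
      using closed[of X "J X" v] True
      by (simp add: bracket_A vk AY Av AJv \<omega>_simps A_simps m_def[symmetric] m' sw
          b_def[symmetric] c_def[symmetric] algebra_simps)
    moreover have "(a + p) * c - q * b = 0"
      using closed[of X "J X" "J v"] True
      by (simp add: bracket_A vk AY Av AJv \<omega>_simps A_simps m_def[symmetric] m' sw
          b_def[symmetric] c_def[symmetric] algebra_simps)
    ultimately have "((a + p) * (a + p) + q * q) * (b * b + c * c) = 0" by algebra
    moreover have "b * b + c * c \<noteq> 0"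
    proof
      assume "b * b + c * c = 0"
      then have bc: "b = 0" "c = 0" by (simp_all add: sum_squares_eq_zero_iff)
      have "v = 0"
      proof (rule \<omega>_zero_adapted[OF ad])
        show "\<omega> v (J X) = 0" using bc sw by (simp add: b_def)
        show "\<omega> v X = 0" using \<omega>_J[of v X] bc sw by (simp add: c_def)
      qed (use True in \<open>simp_all add: \<omega>_self m_def\<close>)
      then show False using ad by (simp add: adapted_def)
    qed
    ultimately have apq: "a = - p" "q = 0" by (auto simp: sum_squares_eq_zero_iff)
    show ?thesis
    proof (cases "p = 0")
      case False
      \<comment> \<open>The eigenvalue -p on JX differs from p on the plane, so a shift removes the
        plane component of A(JX); the factor 2p is this difference.\<close>
      define s' t' where "s' = - s / (2 * p)" and "t' = r / (2 * p)"
      define X' where "X' = X + s' *\<^sub>R v + t' *\<^sub>R J v"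
      have ad': "adapted J k X' v" unfolding X'_def by (rule adapted_shift[OF ad])
      have st: "r = 2 * p * t'" "s = - 2 * p * s'" using False by (simp_all add: s'_def t'_def)
      have "A (J X') = - p *\<^sub>R J X'"
        by (simp add: X'_def J_simps A_simps AY Av AJv apq st vec_eq_iff algebra_simps)
      then show ?thesis
        using reflection[OF ad' False] Av AJv apq by simp
    next
      case p: True
      have Ah: "A v = 0" "A (J v) = 0" using Av AJv p apq by simp_all
      \<comment> \<open>Now A(JX) lies in the plane that A kills. If it is nonzero, it replaces
        v.\<close>
      define u where "u = r *\<^sub>R v + s *\<^sub>R J v"
      have AYu: "A (J X) = u" using AY apq p by (simp add: u_def)
      have u: "u $ k = 0" "J u $ k = 0" "A u = 0" "A (J u) = 0"
        using vk by (simp_all add: u_def J_simps A_simps Ah)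
      show ?thesis
      proof (cases "u = 0")
        case True
        then show ?thesis using isotypic[OF ad, of 0 0] Ah AYu by simp
      next
        case False
        then show ?thesis using nilpotent[OF adapted_change[OF ad False u(1,2)] AYu u(3,4)] by simp
      qed
    qed
  qed
qed

end

text \<open>Adjacent transpositions generate all orders. They move the adapted frame X, JX, v, Jv
  into the order of a listed basis.\<close>

lemma independent4_swap:
  assumes "independent4 a b c d"
  shows "independent4 b a c d" "independent4 a c b d" "independent4 a b d c"
proof -
  have *: "p *\<^sub>R a + q *\<^sub>R b + r *\<^sub>R c + s *\<^sub>R d = 0 \<Longrightarrow> p = 0 \<and> q = 0 \<and> r = 0 \<and> s = 0" for p q r s
    using assms unfolding independent4_def by blast
  show "independent4 b a c d"
    unfolding independent4_def
  proof (intro allI impI)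
    fix p q r s assume "p *\<^sub>R b + q *\<^sub>R a + r *\<^sub>R c + s *\<^sub>R d = 0"
    then show "p = 0 \<and> q = 0 \<and> r = 0 \<and> s = 0" using *[of q p r s] by (simp add: ac_simps)
  qed
  show "independent4 a c b d"
    unfolding independent4_def
  proof (intro allI impI)
    fix p q r s assume "p *\<^sub>R a + q *\<^sub>R c + r *\<^sub>R b + s *\<^sub>R d = 0"
    then show "p = 0 \<and> q = 0 \<and> r = 0 \<and> s = 0" using *[of p r q s] by (simp add: ac_simps)
  qed
  show "independent4 a b d c"
    unfolding independent4_def
  proof (intro allI impI)
    fix p q r s assume "p *\<^sub>R a + q *\<^sub>R b + r *\<^sub>R d + s *\<^sub>R c = 0"
    then show "p = 0 \<and> q = 0 \<and> r = 0 \<and> s = 0" using *[of p q s r] by (simp add: ac_simps)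
  qed
qed

lemma independent4_scale:
  assumes "independent4 a b c d" "r \<noteq> 0" "s \<noteq> 0" "t \<noteq> 0" "u \<noteq> 0"
  shows "independent4 (r *\<^sub>R a) (s *\<^sub>R b) (t *\<^sub>R c) (u *\<^sub>R d)"
  unfolding independent4_def
proof (intro allI impI)
  fix p1 p2 p3 p4
  assume "p1 *\<^sub>R r *\<^sub>R a + p2 *\<^sub>R s *\<^sub>R b + p3 *\<^sub>R t *\<^sub>R c + p4 *\<^sub>R u *\<^sub>R d = 0"
  then have "(p1 * r) *\<^sub>R a + (p2 * s) *\<^sub>R b + (p3 * t) *\<^sub>R c + (p4 * u) *\<^sub>R d = 0" by simp
  then have "p1 * r = 0 \<and> p2 * s = 0 \<and> p3 * t = 0 \<and> p4 * u = 0"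
    using assms(1) unfolding independent4_def by blast
  then show "p1 = 0 \<and> p2 = 0 \<and> p3 = 0 \<and> p4 = 0" using assms by simp
qed

text \<open>Naming every value by a variable separates the computation with the actual vectors from
  the computation with the table of g.\<close>

lemma equivalent_csI':
  fixes u1 u2 u3 u4 :: "real^4" and g :: solv4
  defines "F \<equiv> frame u1 u2 u3 u4" and "B \<equiv> bracket g"
  assumes "linear J" "linear J'" "independent4 u1 u2 u3 u4"
    and "B u1 u2 = b12" "B u1 u3 = b13" "B u1 u4 = b14" "B u2 u3 = b23" "B u2 u4 = b24" "B u3 u4 = b34"
    and "J u1 = j1" "J u2 = j2" "J u3 = j3" "J u4 = j4"
    and "F (B (bv 1) (bv 2)) = b12" "F (B (bv 1) (bv 3)) = b13" "F (B (bv 1) (bv 4)) = b14"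
    "F (B (bv 2) (bv 3)) = b23" "F (B (bv 2) (bv 4)) = b24" "F (B (bv 3) (bv 4)) = b34"
    and "F (J' (bv 1)) = j1" "F (J' (bv 2)) = j2" "F (J' (bv 3)) = j3" "F (J' (bv 4)) = j4"
  shows "equivalent_cs B J J'"
  using equivalent_csI[of J J' u1 u2 u3 u4 g] assms by simp

section \<open>Identities that tell the three shapes apart\<close>

context almost_abelian
begin

text \<open>Cayley-Hamilton for A on h, with characteristic polynomial (t - a)(t^2 + q^2). Its use
  at basis vectors needs no knowledge of X and v.\<close>

lemma isotypic_poly:
  assumes ad: "adapted J k X v" and A: "A (J X) = a *\<^sub>R J X" "A v = q *\<^sub>R J v" "A (J v) = - q *\<^sub>R v"
    and y: "y $ k = 0"
  shows "A (A (A y)) = a *\<^sub>R A (A y) - q\<^sup>2 *\<^sub>R A y + (a * q\<^sup>2) *\<^sub>R y"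
proof -
  obtain r s t where e: "y = r *\<^sub>R J X + s *\<^sub>R v + t *\<^sub>R J v" using adapted_hyperplane[OF ad y] .
  show ?thesis
    unfolding e by (simp add: A_simps A vec_eq_iff power2_eq_square algebra_simps)
qed

text \<open>For q = 0 the map A on h has image in the line of JX. The cubic identity alone would
  still permit a nilpotent block.\<close>

lemma isotypic_real:
  assumes ad: "adapted J k X v" and A: "A (J X) = a *\<^sub>R J X" "A v = 0" "A (J v) = 0"
    and y: "y $ k = 0"
  shows "A (A y) = a *\<^sub>R A y" "\<exists>c. A y = c *\<^sub>R J X" "a = 0 \<Longrightarrow> A y = 0"
proof -
  obtain r s t where e: "y = r *\<^sub>R J X + s *\<^sub>R v + t *\<^sub>R J v" using adapted_hyperplane[OF ad y] .
  then have "A y = (r * a) *\<^sub>R J X" by (simp add: A_simps A)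
  then show "A (A y) = a *\<^sub>R A y" "\<exists>c. A y = c *\<^sub>R J X" "a = 0 \<Longrightarrow> A y = 0"
    by (auto simp: A_simps A)
qed

lemma reflection_square:
  assumes ad: "adapted J k X v" and A: "A (J X) = - p *\<^sub>R J X" "A v = p *\<^sub>R v" "A (J v) = p *\<^sub>R J v"
    and y: "y $ k = 0"
  shows "A (A y) = p\<^sup>2 *\<^sub>R y"
proof -
  obtain r s t where e: "y = r *\<^sub>R J X + s *\<^sub>R v + t *\<^sub>R J v" using adapted_hyperplane[OF ad y] .
  show ?thesis
    unfolding e by (simp add: A_simps A vec_eq_iff power2_eq_square algebra_simps)
qed

text \<open>On h the eigenvalue -p is simple, as p is double and different from it.\<close>

lemma reflection_eigenline:
  assumes ad: "adapted J k X v" and p: "p \<noteq> 0"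
    and A: "A (J X) = - p *\<^sub>R J X" "A v = p *\<^sub>R v" "A (J v) = p *\<^sub>R J v"
    and y: "y $ k = 0" "A y = - p *\<^sub>R y"
  obtains c where "y = c *\<^sub>R J X"
proof -
  obtain r s t where e: "y = r *\<^sub>R J X + s *\<^sub>R v + t *\<^sub>R J v" using adapted_hyperplane[OF ad y(1)] .
  have "p *\<^sub>R (s *\<^sub>R v + t *\<^sub>R J v) = - p *\<^sub>R (s *\<^sub>R v + t *\<^sub>R J v)"
    using y(2) by (simp add: e A_simps A vec_eq_iff algebra_simps)
  then have "(2 * p) *\<^sub>R (s *\<^sub>R v + t *\<^sub>R J v) = 0"
    by (simp add: vec_eq_iff)
  then have "s *\<^sub>R v + t *\<^sub>R J v = 0" using p by simp
  then show ?thesis using e that[of r] by (simp add: add.assoc)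
qed

lemma nilpotent_square:
  assumes ad: "adapted J k X v" and A: "A (J X) = v" "A v = 0" "A (J v) = 0" and y: "y $ k = 0"
  shows "A (A y) = 0"
proof -
  obtain r s t where "y = r *\<^sub>R J X + s *\<^sub>R v + t *\<^sub>R J v" using adapted_hyperplane[OF ad y] .
  then show ?thesis by (simp add: A_simps A)
qed

end

section \<open>The individual almost abelian algebras\<close>

context pseudo_kahler
begin

lemma almost_abelianI:
  assumes "\<And>x y. bracket g x y = x $ k *\<^sub>R bracket g (bv k) y - y $ k *\<^sub>R bracket g (bv k) x"
    and "\<And>y. bracket g (bv k) y $ k = 0"
  shows "almost_abelian g J \<omega> k (bracket g (bv k))"
proof (intro almost_abelian.intro almost_abelian_axioms.intro pseudo_kahler_axioms)
  show "linear (bracket g (bv k))" using bilinear_bracket[of g] by (simp add: bilinear_def)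
qed (use assms in blast)+

lemma RH3_equivalent:
  assumes G: "g = RH3"
  shows "\<exists>J' \<Omega>. kahler_list g J' \<Omega> \<and> equivalent_cs (bracket g) J J'"
proof -
  define A where "A = bracket g (bv 1)"
  have A: "A y = y$2 *\<^sub>R bv 3" for y by (simp add: A_def G coord_simps)
  interpret almost_abelian g J \<omega> 1 A
    unfolding A_def by (rule almost_abelianI) (simp_all add: G coord_simps)
  show ?thesis
  proof (cases rule: adapted_normal_form)
    case (isotypic a q X v)
    have q: "q = 0" using isotypic_poly[OF isotypic, of "bv 2"] by (simp add: A coord_simps)
    then have Av: "A v = 0" "A (J v) = 0" using isotypic by simp_all
    note R = isotypic_real[OF isotypic(1,2) Av, of "bv 2"]
    have "a = 0" using R(1) by (simp add: A coord_simps)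
    then have False using R(3) by (simp add: A coord_simps)
    then show ?thesis ..
  next
    case (reflection p X v)
    \<comment> \<open>\<open>bv 4\<close> is in the kernel of A, whereas A^2 = p^2 is invertible on
      h.\<close>
    have False using reflection_square[OF reflection(1,3,4,5), of "bv 4"] reflection(2)
      by (simp add: A coord_simps)
    then show ?thesis ..
  next
    case (nilpotent X v)
    have k: "X$1 = 1" "J X$1 = 0" "v$1 = 0" "J v$1 = 0" using nilpotent(1) by (auto simp: adapted_def)
    have b: "bracket g X (J X) = v" "bracket g X v = 0" "bracket g X (J v) = 0"
      "bracket g (J X) v = 0" "bracket g (J X) (J v) = 0" "bracket g v (J v) = 0"
      by (simp_all add: bracket_A k nilpotent)
    have j: "J X = J X" "J (J X) = - X" "J v = J v" "J (J v) = - v" by (simp_all add: J_J)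
    have "equivalent_cs (bracket g) J (cs_ext [(1, 1, 2), (3, 1, 4)])"
      by (rule equivalent_csI'[OF linear_J linear_cs_ext adapted_independent4[OF nilpotent(1)] b j])
        (simp_all add: G frame_def coord_simps)
    then show ?thesis using G kahler_list.rh3 by blast
  qed
qed


text \<open>A has a Jordan block for the eigenvalue 1. In the isotypic shape 1 would be a double
  root of (t - a)(t^2 + q^2); but a = 1, and the derivative at 1 is then 1 + q^2.\<close>

lemma not_RR3: "g \<noteq> RR3"
proof
  assume G: "g = RR3"
  define A where "A = bracket g (bv 1)"
  have A: "A y = (y$2 + y$3) *\<^sub>R bv 2 + y$3 *\<^sub>R bv 3" for y by (simp add: A_def G coord_simps)
  interpret almost_abelian g J \<omega> 1 A
    unfolding A_def by (rule almost_abelianI) (simp_all add: G coord_simps algebra_simps)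
  show False
  proof (cases rule: adapted_normal_form)
    case (isotypic a q X v)
    note P = isotypic_poly[OF isotypic]
    have "1 + q\<^sup>2 \<noteq> 0" using zero_le_power2[of q] by linarith
    moreover have "1 = a - q\<^sup>2 + a * q\<^sup>2" using P[of "bv 2"] by (simp add: A coord_simps)
    moreover have "3 = 2 * a - q\<^sup>2" using P[of "bv 3"] by (simp add: A coord_simps)
    ultimately show False by algebra
  next
    case (reflection p X v)
    show False using reflection_square[OF reflection(1,3,4,5), of "bv 4"] reflection(2)
      by (simp add: A coord_simps)
  next
    case (nilpotent X v)
    show False using nilpotent_square[OF nilpotent, of "bv 2"] by (simp add: A coord_simps)
  qed
qed

lemma RR3_lam_equivalent:
  assumes G: "g = RR3_lam l"
  shows "\<exists>J' \<Omega>. kahler_list g J' \<Omega> \<and> equivalent_cs (bracket g) J J'"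
proof -
  define A where "A = bracket g (bv 1)"
  have A: "A y = y$2 *\<^sub>R bv 2 + (l * y$3) *\<^sub>R bv 3" for y by (simp add: A_def G coord_simps)
  interpret almost_abelian g J \<omega> 1 A
    unfolding A_def by (rule almost_abelianI) (simp_all add: G coord_simps algebra_simps)
  show ?thesis
  proof (cases rule: adapted_normal_form)
    case (isotypic a q X v)
    note P = isotypic_poly[OF isotypic]
    have "1 + q\<^sup>2 \<noteq> 0" using zero_le_power2[of q] by linarith
    moreover have "1 = a - q\<^sup>2 + a * q\<^sup>2" using P[of "bv 2"] by (simp add: A coord_simps)
    ultimately have a: "a = 1" by algebra
    have q: "q = 0" using P[of "bv 4"] a by (simp add: A coord_simps)
    have Av: "A v = 0" "A (J v) = 0" using isotypic q by simp_all
    note R = isotypic_real(2)[OF isotypic(1,2) Av]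
    obtain c2 where c2: "A (bv 2) = c2 *\<^sub>R J X" using R[of "bv 2"] by (auto simp: axis_def)
    obtain c3 where c3: "A (bv 3) = c3 *\<^sub>R J X" using R[of "bv 3"] by (auto simp: axis_def)
    have "1 = c2 * J X $ 2" "0 = c2 * J X $ 3" "0 = c3 * J X $ 2" "l = c3 * J X $ 3"
      using c2 c3 by (simp_all add: A coord_simps)
    \<comment> \<open>The eigenvectors \<open>bv 2\<close> and \<open>bv 3\<close> cannot both have
      a nonzero image in the line of JX.\<close>
    then have l: "l = 0" by algebra
    have k: "X$1 = 1" "J X$1 = 0" "v$1 = 0" "J v$1 = 0" using isotypic(1) by (auto simp: adapted_def)
    have b: "bracket g X (J X) = J X" "bracket g X v = 0" "bracket g X (J v) = 0"
      "bracket g (J X) v = 0" "bracket g (J X) (J v) = 0" "bracket g v (J v) = 0"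
      by (simp_all add: bracket_A k isotypic a q)
    have j: "J X = J X" "J (J X) = - X" "J v = J v" "J (J v) = - v" by (simp_all add: J_J)
    have "equivalent_cs (bracket g) J (cs_ext [(1, 1, 2), (3, 1, 4)])"
      by (rule equivalent_csI'[OF linear_J linear_cs_ext adapted_independent4[OF isotypic(1)] b j])
        (simp_all add: G l frame_def coord_simps)
    then show ?thesis using G l kahler_list.rr3_0 by blast
  next
    case (reflection p X v)
    have False using reflection_square[OF reflection(1,3,4,5), of "bv 4"] reflection(2)
      by (simp add: A coord_simps)
    then show ?thesis ..
  next
    case (nilpotent X v)
    have False using nilpotent_square[OF nilpotent, of "bv 2"] by (simp add: A coord_simps)
    then show ?thesis ..
  qed
qed

lemma RR3'_gam_equivalent:
  assumes G: "g = RR3'_gam c"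
  shows "\<exists>J' \<Omega>. kahler_list g J' \<Omega> \<and> equivalent_cs (bracket g) J J'"
proof -
  define A where "A = bracket g (bv 1)"
  have A: "A y = (c * y$2 + y$3) *\<^sub>R bv 2 + (c * y$3 - y$2) *\<^sub>R bv 3" for y
    by (simp add: A_def G coord_simps)
  interpret almost_abelian g J \<omega> 1 A
    unfolding A_def by (rule almost_abelianI) (simp_all add: G coord_simps algebra_simps)
  show ?thesis
  proof (cases rule: adapted_normal_form)
    case (isotypic a q X v)
    note P = isotypic_poly[OF isotypic]
    \<comment> \<open>If q were 0, A would have rank at most one on h, but its determinant on e_2,
      e_3 is c^2 + 1.\<close>
    have q: "q \<noteq> 0"
    proof
      assume q: "q = 0"
      have Av: "A v = 0" "A (J v) = 0" using isotypic q by simp_all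
    note R = isotypic_real(2)[OF isotypic(1,2) Av]
      obtain c2 where c2: "A (bv 2) = c2 *\<^sub>R J X" using R[of "bv 2"] by (auto simp: axis_def)
      obtain c3 where c3: "A (bv 3) = c3 *\<^sub>R J X" using R[of "bv 3"] by (auto simp: axis_def)
      have "c = c2 * J X $ 2" "- 1 = c2 * J X $ 3" "1 = c3 * J X $ 2" "c = c3 * J X $ 3"
        using c2 c3 by (simp_all add: A coord_simps)
      then have "c * c + 1 = 0" by algebra
      then show False using zero_le_square[of c] by linarith
    qed
    then have a: "a = 0" using P[of "bv 4"] by (simp add: A coord_simps)
    \<comment> \<open>The numbers c + i and c - i are roots of t(t^2 + q^2), hence purely imaginary:
      c = 0 and q^2 = 1.\<close>
    have e: "c * (c * c - 1) - c - c = - (q\<^sup>2 * c)" "1 - 3 * (c * c) = q\<^sup>2"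
      using P[of "bv 2"] by (simp_all add: A a coord_simps algebra_simps)
    then have "c * (c * c + 1) = 0" by algebra
    moreover have "c * c + 1 \<noteq> 0" using zero_le_square[of c] by linarith
    ultimately have c: "c = 0" by simp
    have q1: "q = 1 \<or> q = -1" using e c by (simp add: power2_eq_1_iff)
    have k: "X$1 = 1" "J X$1 = 0" "v$1 = 0" "J v$1 = 0" using isotypic(1) by (auto simp: adapted_def)
    have qq: "q * q = 1" using q1 by auto
    \<comment> \<open>Multiplying X and JX by -q absorbs the sign of q, so this item needs one J
      only.\<close>
    let ?X = "(- q) *\<^sub>R X" and ?v = "1 *\<^sub>R v" and ?w = "1 *\<^sub>R J v" and ?Y = "(- q) *\<^sub>R J X"
    have ind: "independent4 ?X ?v ?w ?Y"
      using independent4_scale[OF independent4_swap(3)[OF independent4_swap(2)[OF adapted_independent4[OF isotypic(1)]]],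
          of "- q" 1 1 "- q"] q by simp
    have b: "bracket g ?X ?v = - J v" "bracket g ?X ?w = v" "bracket g ?X ?Y = 0"
      "bracket g ?v ?w = 0" "bracket g ?v ?Y = 0" "bracket g ?w ?Y = 0"
      by (simp_all add: bracket_A k isotypic A_simps a qq)
    have j: "J ?X = ?Y" "J ?v = ?w" "J ?w = - ?v" "J ?Y = - ?X" by (simp_all add: J_simps)
    have "equivalent_cs (bracket g) J (cs_ext [(1, 1, 4), (2, 1, 3)])"
      by (rule equivalent_csI'[OF linear_J linear_cs_ext ind b j])
        (simp_all add: G c frame_def coord_simps)
    then show ?thesis using G c kahler_list.rr3'_0 by blast
  next
    case (reflection p X v)
    have False using reflection_square[OF reflection(1,3,4,5), of "bv 4"] reflection(2)
      by (simp add: A coord_simps)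
    then show ?thesis ..
  next
    case (nilpotent X v)
    have False using nilpotent_square[OF nilpotent, of "bv 2"]
      by (auto simp: A coord_simps algebra_simps)
    then show ?thesis ..
  qed
qed

text \<open>A is a nilpotent block of size three. The cubic identity forces a = q = 0, hence A = 0
  on h; the nilpotent shape would need A^2 = 0.\<close>

lemma not_N4: "g \<noteq> N4"
proof
  assume G: "g = N4"
  define A where "A = bracket g (bv 4)"
  have A: "A y = y$1 *\<^sub>R bv 2 + y$2 *\<^sub>R bv 3" for y by (simp add: A_def G coord_simps)
  interpret almost_abelian g J \<omega> 4 A
    unfolding A_def by (rule almost_abelianI) (simp_all add: G coord_simps algebra_simps)
  show False
  proof (cases rule: adapted_normal_form)
    case (isotypic a q X v)
    have q: "q = 0" "a = 0" using isotypic_poly[OF isotypic, of "bv 1"] by (simp_all add: A coord_simps)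
    have Av: "A v = 0" "A (J v) = 0" using isotypic q by simp_all
    have "A (bv 1) = 0"
      using isotypic_real(3)[OF isotypic(1,2) Av, of "bv 1"] q by (simp add: axis_def)
    then show False by (simp add: A coord_simps)
  next
    case (reflection p X v)
    show False using reflection_square[OF reflection(1,3,4,5), of "bv 3"] reflection(2)
      by (simp add: A coord_simps)
  next
    case (nilpotent X v)
    show False using nilpotent_square[OF nilpotent, of "bv 1"] by (simp add: A coord_simps)
  qed
qed

lemma not_R4: "g \<noteq> R4"
proof
  assume G: "g = R4"
  define A where "A = bracket g (bv 4)"
  have A: "A y = (y$1 + y$2) *\<^sub>R bv 1 + (y$2 + y$3) *\<^sub>R bv 2 + y$3 *\<^sub>R bv 3" for y
    by (simp add: A_def G coord_simps)
  interpret almost_abelian g J \<omega> 4 A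
    unfolding A_def by (rule almost_abelianI) (simp_all add: G coord_simps algebra_simps)
  show False
  proof (cases rule: adapted_normal_form)
    case (isotypic a q X v)
    note P = isotypic_poly[OF isotypic]
    have "1 + q\<^sup>2 \<noteq> 0" using zero_le_power2[of q] by linarith
    moreover have "1 = a - q\<^sup>2 + a * q\<^sup>2" using P[of "bv 1"] by (simp add: A coord_simps)
    moreover have "3 = 2 * a - q\<^sup>2" using P[of "bv 2"] by (simp add: A coord_simps)
    ultimately show False by algebra
  next
    case (reflection p X v)
    show False using reflection_square[OF reflection(1,3,4,5), of "bv 2"]
      by (simp add: A coord_simps)
  next
    case (nilpotent X v)
    show False using nilpotent_square[OF nilpotent, of "bv 1"] by (simp add: A coord_simps)
  qed
qed

text \<open>In the isotypic shape m is a double root of (t - 1)(t^2 + q^2). The value m = 1 is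
  impossible, since the derivative there is 1 + q^2; so m = q = 0, and then A^2 = A on h, against
  e_3 -> e_2 -> 0.\<close>

lemma not_R4_mu: "g \<noteq> R4_mu m"
proof
  assume G: "g = R4_mu m"
  define A where "A = bracket g (bv 4)"
  have A: "A y = y$1 *\<^sub>R bv 1 + (m * y$2 + y$3) *\<^sub>R bv 2 + (m * y$3) *\<^sub>R bv 3" for y
    by (simp add: A_def G coord_simps algebra_simps)
  interpret almost_abelian g J \<omega> 4 A
    unfolding A_def by (rule almost_abelianI) (simp_all add: G coord_simps algebra_simps)
  show False
  proof (cases rule: adapted_normal_form)
    case (isotypic a q X v)
    note P = isotypic_poly[OF isotypic]
    have q0: "1 + q\<^sup>2 \<noteq> 0" using zero_le_power2[of q] by linarith
    moreover have "1 = a - q\<^sup>2 + a * q\<^sup>2" using P[of "bv 1"] by (simp add: A coord_simps)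
    ultimately have a: "a = 1" by algebra
    have "m * m * m = m * m - q\<^sup>2 * m + q\<^sup>2"
      using P[of "bv 2"] by (simp add: A a coord_simps algebra_simps)
    then have e2: "(m - 1) * (m\<^sup>2 + q\<^sup>2) = 0" by algebra
    have e3: "3 * (m * m) = 2 * m - q\<^sup>2"
      using P[of "bv 3"] by (simp add: A a coord_simps algebra_simps)
    have "m \<noteq> 1" using e3 q0 by auto
    then have "m\<^sup>2 + q\<^sup>2 = 0" using e2 by simp
    then have mq: "m = 0" "q = 0" by (simp_all add: sum_power2_eq_zero_iff)
    have Av: "A v = 0" "A (J v) = 0" using isotypic mq by simp_all
    have "A (A (bv 3)) = a *\<^sub>R A (bv 3)"
      using isotypic_real(1)[OF isotypic(1,2) Av, of "bv 3"] by (simp add: axis_def)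
    then show False by (simp add: A mq a coord_simps)
  next
    case (reflection p X v)
    show False
      using reflection_square[OF reflection(1,3,4,5), of "bv 3"] reflection(2)
      by (auto simp: A coord_simps)
  next
    case (nilpotent X v)
    show False using nilpotent_square[OF nilpotent, of "bv 1"] by (simp add: A coord_simps)
  qed
qed

lemma R4_ab_equivalent:
  assumes G: "g = R4_ab \<alpha> \<beta>" and valid: "valid_params g"
  shows "\<exists>J' \<Omega>. kahler_list g J' \<Omega> \<and> equivalent_cs (bracket g) J J'"
proof -
  have ab: "\<alpha> \<noteq> 0" "\<beta> \<noteq> 0" "\<alpha> \<le> \<beta>" using valid G by auto
  define A where "A = bracket g (bv 4)"
  have A: "A y = y$1 *\<^sub>R bv 1 + (\<alpha> * y$2) *\<^sub>R bv 2 + (\<beta> * y$3) *\<^sub>R bv 3" for y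
    by (simp add: A_def G coord_simps)
  interpret almost_abelian g J \<omega> 4 A
    unfolding A_def by (rule almost_abelianI) (simp_all add: G coord_simps algebra_simps)
  show ?thesis
  proof (cases rule: adapted_normal_form)
    case (isotypic a q X v)
    note P = isotypic_poly[OF isotypic]
    have q0: "1 + q\<^sup>2 \<noteq> 0" using zero_le_power2[of q] by linarith
    moreover have "1 = a - q\<^sup>2 + a * q\<^sup>2" using P[of "bv 1"] by (simp add: A coord_simps)
    ultimately have a: "a = 1" by algebra
    have "(\<alpha> - 1) * (\<alpha>\<^sup>2 + q\<^sup>2) = 0"
      using P[of "bv 2"] by (simp add: A a coord_simps algebra_simps power2_eq_square)
    then have \<alpha>: "\<alpha> = 1" using ab by (simp add: sum_power2_eq_zero_iff)
    have "(\<beta> - 1) * (\<beta>\<^sup>2 + q\<^sup>2) = 0"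
      using P[of "bv 3"] by (simp add: A a coord_simps algebra_simps power2_eq_square)
    then have \<beta>: "\<beta> = 1" using ab by (simp add: sum_power2_eq_zero_iff)
    \<comment> \<open>A is now the identity on h, while A^2 acts on the J-invariant plane as
      -q^2.\<close>
    have Av: "A v = v" using isotypic(1) by (simp add: A \<alpha> \<beta> adapted_def vec_eq_iff forall_4 axis_def)
    then have "v = A (A v)" by simp
    also have "\<dots> = - q\<^sup>2 *\<^sub>R v" by (simp add: isotypic A_simps power2_eq_square)
    finally have "(1 + q\<^sup>2) *\<^sub>R v = 0" by (simp add: scaleR_add_left eq_neg_iff_add_eq_0)
    then have False using q0 isotypic(1) by (simp add: adapted_def)
    then show ?thesis ..
  next
    case (reflection p X v)
    note S = reflection_square[OF reflection(1,3,4,5)]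
    have p: "p\<^sup>2 = 1" using S[of "bv 1"] by (simp add: A coord_simps)
    have "\<alpha>\<^sup>2 = 1" using S[of "bv 2"] p by (simp add: A coord_simps power2_eq_square)
    then have \<alpha>: "\<alpha> = 1 \<or> \<alpha> = -1" by (simp add: power2_eq_1_iff)
    have "\<beta>\<^sup>2 = 1" using S[of "bv 3"] p by (simp add: A coord_simps power2_eq_square)
    then have \<beta>: "\<beta> = 1 \<or> \<beta> = -1" by (simp add: power2_eq_1_iff)
    note L = reflection_eigenline[OF reflection]
    have k: "X$4 = 1" "J X$4 = 0" "v$4 = 0" "J v$4 = 0" using reflection(1) by (auto simp: adapted_def)
    have p': "p = 1 \<or> p = -1" using p by (simp add: power2_eq_1_iff)
    \<comment> \<open>The eigenvalue -p is simple, so two basis vectors cannot share it; this reads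
      p off from \<alpha> and \<beta>.\<close>
    have two: False if eig: "A (bv i) = - p *\<^sub>R bv i" "A (bv j) = - p *\<^sub>R bv j" "i \<noteq> j" "i \<noteq> 4" "j \<noteq> 4" for i j
    proof -
      have "bv i $ 4 = 0" using eig by (auto simp: axis_def)
      then obtain c where c: "bv i = c *\<^sub>R J X" using L eig(1) by blast
      have "bv j $ 4 = 0" using eig by (auto simp: axis_def)
      then obtain d where d: "bv j = d *\<^sub>R J X" using L eig(2) by blast
      have "bv i $ i = c * J X $ i" "bv i $ j = c * J X $ j" "bv j $ i = d * J X $ i" "bv j $ j = d * J X $ j"
        using c d by simp_all
      then have "1 = c * J X $ i" "0 = c * J X $ j" "0 = d * J X $ i" "1 = d * J X $ j"
        using eig(3) by (auto simp: axis_def)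
      then show False by algebra
    qed
    note ind = adapted_independent4[OF reflection(1)]
    show ?thesis
    proof (cases "\<alpha> = 1")
      case True
      then have \<beta>1: "\<beta> = 1" using \<beta> ab by auto
      have Ay: "A y = y" if "y $ 4 = 0" for y
        using that by (simp add: A True \<beta>1 vec_eq_iff forall_4 axis_def)
      have nz: "J X \<noteq> 0" using k J_J[of X] by (metis J_simps(5) neg_0_equal_iff_equal zero_index zero_neq_one)
      have e: "J X = - (p *\<^sub>R J X)" "v = p *\<^sub>R v" using Ay[OF k(2)] Ay[OF k(3)] reflection(3,4) by simp_all
      have "J X + p *\<^sub>R J X = 0" using e(1) eq_neg_iff_add_eq_0[of "J X" "p *\<^sub>R J X"] by blast
      moreover have "v - p *\<^sub>R v = 0" using e(2) eq_iff_diff_eq_0[of v "p *\<^sub>R v"] by blast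
      ultimately have "(1 + p) *\<^sub>R J X = 0" "(1 - p) *\<^sub>R v = 0" by (simp_all add: algebra_simps)
      then have False using nz reflection(1) by (simp add: adapted_def)
      then show ?thesis ..
    next
      case False
      then have \<alpha>1: "\<alpha> = -1" using \<alpha> by simp
      show ?thesis
      proof (cases "\<beta> = 1")
        case True
        have p1: "p = 1"
        proof (rule ccontr)
          assume "p \<noteq> 1"
          then have "p = -1" using p' by simp
          then show False using two[of 1 3] by (simp add: A True coord_simps)
        qed
        have i: "independent4 v (J X) (J v) X"
          using independent4_swap(1)[OF independent4_swap(3)[OF independent4_swap(2)[OF independent4_swap(1)[OF ind]]]] .
        have b: "bracket g v (J X) = 0" "bracket g v (J v) = 0" "bracket g v X = - v"
          "bracket g (J X) (J v) = 0" "bracket g (J X) X = J X" "bracket g (J v) X = - J v"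
          by (simp_all add: bracket_A k reflection p1)
        have j: "J v = J v" "J (J X) = - X" "J (J v) = - v" "J X = J X" by (simp_all add: J_J)
        have "equivalent_cs (bracket g) J (cs_ext [(4, 1, 2), (1, 1, 3)])"
          by (rule equivalent_csI'[OF linear_J linear_cs_ext i b j])
            (simp_all add: G \<alpha>1 True frame_def coord_simps)
        then show ?thesis using G \<alpha>1 True kahler_list.r4_m1_p1 by blast
      next
        case False
        then have \<beta>1: "\<beta> = -1" using \<beta> by simp
        have p1: "p = -1"
        proof (rule ccontr)
          assume "p \<noteq> -1"
          then have "p = 1" using p' by simp
          then show False using two[of 2 3] by (simp add: A \<alpha>1 \<beta>1 coord_simps)
        qed
        have i: "independent4 (J X) v (J v) X"
          using independent4_swap(3)[OF independent4_swap(2)[OF independent4_swap(1)[OF ind]]] .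
        have b: "bracket g (J X) v = 0" "bracket g (J X) (J v) = 0" "bracket g (J X) X = - J X"
          "bracket g v (J v) = 0" "bracket g v X = v" "bracket g (J v) X = J v"
          by (simp_all add: bracket_A k reflection p1)
        have j: "J (J X) = - X" "J v = J v" "J (J v) = - v" "J X = J X" by (simp_all add: J_J)
        have "equivalent_cs (bracket g) J (cs_ext [(4, 1, 1), (2, 1, 3)])"
          by (rule equivalent_csI'[OF linear_J linear_cs_ext i b j])
            (simp_all add: G \<alpha>1 \<beta>1 frame_def coord_simps)
        then show ?thesis using G \<alpha>1 \<beta>1 kahler_list.r4_m1_m1 by blast
      qed
    qed
  next
    case (nilpotent X v)
    have False using nilpotent_square[OF nilpotent, of "bv 1"] by (simp add: A coord_simps)
    then show ?thesis ..
  qed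
qed

lemma R4'_gd_equivalent:
  assumes G: "g = R4'_gd c d" and valid: "valid_params g"
  shows "\<exists>J' \<Omega>. kahler_list g J' \<Omega> \<and> equivalent_cs (bracket g) J J'"
proof -
  have d: "d > 0" using valid G by auto
  define A where "A = bracket g (bv 4)"
  have A: "A y = y$1 *\<^sub>R bv 1 + (c * y$2 + d * y$3) *\<^sub>R bv 2 + (c * y$3 - d * y$2) *\<^sub>R bv 3" for y
    by (simp add: A_def G coord_simps algebra_simps)
  interpret almost_abelian g J \<omega> 4 A
    unfolding A_def by (rule almost_abelianI) (simp_all add: G coord_simps algebra_simps)
  show ?thesis
  proof (cases rule: adapted_normal_form)
    case (isotypic a q X v)
    note P = isotypic_poly[OF isotypic]
    have q0: "1 + q\<^sup>2 \<noteq> 0" using zero_le_power2[of q] by linarith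
    moreover have "1 = a - q\<^sup>2 + a * q\<^sup>2" using P[of "bv 1"] by (simp add: A coord_simps)
    ultimately have a: "a = 1" by algebra
    \<comment> \<open>The non-real number c + id is a root of (t - 1)(t^2 + q^2), hence equals iq or
      -iq.\<close>
    have e: "c * (c * c - d * d) - d * (2 * c * d) = (c * c - d * d) - q\<^sup>2 * c + q\<^sup>2"
      "d * (d * d - 3 * (c * c)) = - 2 * c * d + q\<^sup>2 * d"
      using P[of "bv 2"] by (simp_all add: A a coord_simps algebra_simps)
    have "d * ((c - 1)\<^sup>2 + d\<^sup>2) * c = 0" using e by algebra
    moreover have "(c - 1)\<^sup>2 + d\<^sup>2 \<noteq> 0" using d by (simp add: sum_power2_eq_zero_iff)
    ultimately have c: "c = 0" using d by simp
    have "q\<^sup>2 = d\<^sup>2" using e(2) c d by (simp add: power2_eq_square)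
    then have q: "q = d \<or> q = - d" by (simp add: power2_eq_iff)
    \<comment> \<open>The sign of q cannot be absorbed into X, whose scale is fixed by [X, JX] = JX.
      It goes into e_3 = s Jv and reappears as J e_2 = s e_3.\<close>
    define s where "s = - q / d"
    have s: "q = - s * d" "s = 1 \<or> s = -1" using q d by (auto simp: s_def)
    then have ss: "s * s = 1" "s \<noteq> 0" by auto
    have k: "X$4 = 1" "J X$4 = 0" "v$4 = 0" "J v$4 = 0" using isotypic(1) by (auto simp: adapted_def)
    let ?w = "s *\<^sub>R J v"
    have i: "independent4 (J X) v ?w X"
      using independent4_scale[OF independent4_swap(3)[OF independent4_swap(2)[OF independent4_swap(1)[OF
            adapted_independent4[OF isotypic(1)]]]], of 1 1 s 1] ss by simp
    have b: "bracket g (J X) v = 0" "bracket g (J X) ?w = 0" "bracket g (J X) X = - J X"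
      "bracket g v ?w = 0" "bracket g v X = d *\<^sub>R ?w" "bracket g ?w X = - d *\<^sub>R v"
      using ss by (simp_all add: bracket_A k isotypic A_simps a s(1))
    have j: "J (J X) = - X" "J v = s *\<^sub>R ?w" "J ?w = - s *\<^sub>R v" "J X = J X" by (simp_all add: J_simps ss)
    have "equivalent_cs (bracket g) J (cs_ext [(4, 1, 1), (2, s, 3)])"
      by (rule equivalent_csI'[OF linear_J linear_cs_ext i b j])
        (use s(2) in \<open>auto simp add: G c frame_def coord_simps\<close>)
    moreover have "cs_ext [(4, 1, 1), (2, s, 3)] \<in> {cs_ext [(4, 1, 1), (2, 1, 3)], cs_ext [(4, 1, 1), (2, -1, 3)]}"
      using s(2) by auto
    ultimately show ?thesis using G c kahler_list.r4'_0[OF d] by blast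
  next
    case (reflection p X v)
    note S = reflection_square[OF reflection(1,3,4,5)]
    have "p\<^sup>2 = 1" using S[of "bv 1"] by (simp add: A coord_simps)
    then have "c * c - d * d = 1" "c * d + c * d = 0"
      using S[of "bv 2"] by (simp_all add: A coord_simps algebra_simps)
    then have False using mult_pos_pos[OF d d] by auto
    then show ?thesis ..
  next
    case (nilpotent X v)
    have False using nilpotent_square[OF nilpotent, of "bv 1"] by (simp add: A coord_simps)
    then show ?thesis ..
  qed
qed

end

section \<open>Extensions of the Heisenberg algebra\<close>

text \<open>The matrix b is the action of e_4 on the Heisenberg ideal modulo its center. As ad e_4
  is a derivation and [e_1, e_2] = e_3, it multiplies e_3 by the trace d of b.\<close>

locale heis_extension = pseudo_kahler +
  fixes b11 b12 b21 b22 d \<Delta> :: real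
  assumes bracket_heis: "bracket g x y =
      (x$4 * (b11 * y$1 + b12 * y$2) - y$4 * (b11 * x$1 + b12 * x$2)) *\<^sub>R bv 1
    + (x$4 * (b21 * y$1 + b22 * y$2) - y$4 * (b21 * x$1 + b22 * x$2)) *\<^sub>R bv 2
    + (x$1 * y$2 - x$2 * y$1 + d * (x$4 * y$3 - y$4 * x$3)) *\<^sub>R bv 3"
    and trace: "d = b11 + b22" and det: "\<Delta> = b11 * b22 - b12 * b21"
begin

lemma bracket_4: "bracket g x y $ 4 = 0"
  by (simp add: bracket_heis axis_def)

lemma bracket_12:
  assumes "x $ 4 = 1" "y $ 4 = 0"
  shows "bracket g x y $ 1 = b11 * y$1 + b12 * y$2" "bracket g x y $ 2 = b21 * y$1 + b22 * y$2"
  using assms by (simp_all add: bracket_heis axis_def)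

lemma bracket_nil:
  assumes "x $ 4 = 0" "y $ 4 = 0"
  shows "bracket g x y = (x$1 * y$2 - x$2 * y$1) *\<^sub>R bv 3"
  using assms by (simp add: bracket_heis)

lemma bracket_center:
  shows "bracket g x (bv 3) = (d * x$4) *\<^sub>R bv 3" "bracket g (bv 3) x = - (d * x$4) *\<^sub>R bv 3"
  by (simp_all add: bracket_heis axis_def)

text \<open>If d = 0 and b is invertible, closedness puts e_3 into the kernel of \<omega>: the
  pairings with e_1, e_2 are annihilated by the transpose of b, and the pairing with e_4 is
  proportional to d.\<close>

lemma trace_det_nonzero: "d \<noteq> 0 \<or> \<Delta> = 0"
proof (rule ccontr)
  assume "\<not> ?thesis"
  then have d: "d = 0" and D: "\<Delta> \<noteq> 0" by auto
  let ?a = "\<omega> (bv 1) (bv 3)" and ?b = "\<omega> (bv 2) (bv 3)" and ?c = "\<omega> (bv 3) (bv 4)"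
  have 1: "b11 * ?a + b21 * ?b = 0"
    using closed[of "bv 1" "bv 3" "bv 4"] by (simp add: bracket_heis axis_def d \<omega>_simps)
  have 2: "b12 * ?a + b22 * ?b = 0"
    using closed[of "bv 2" "bv 3" "bv 4"] by (simp add: bracket_heis axis_def d \<omega>_simps)
  have a: "?a = 0" and b: "?b = 0"
  proof -
    have "\<Delta> * ?a = 0" "\<Delta> * ?b = 0" using 1 2 det by algebra+
    then show "?a = 0" "?b = 0" using D by auto
  qed
  have "?c + d * \<omega> (bv 1) (bv 2) = 0"
    using closed[of "bv 1" "bv 2" "bv 4"] \<omega>_swap[of "bv 2" "bv 1"]
    by (simp add: bracket_heis axis_def trace \<omega>_simps algebra_simps)
  then have c: "?c = 0" using d by simp
  have z: "\<omega> (bv 3) (bv 1) = 0" "\<omega> (bv 3) (bv 2) = 0"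
    using a b \<omega>_swap[of "bv 3" "bv 1"] \<omega>_swap[of "bv 3" "bv 2"] by simp_all
  have "\<omega> (bv 3) y = 0" for y
    by (subst vec4_expand[of y]) (simp add: \<omega>_simps z c)
  then have "bv 3 = (0 :: real^4)" by (rule nondegenerate)
  then show False by (simp add: axis_eq_0_iff)
qed

text \<open>The expression is the determinant of the images of x and y modulo the center.\<close>

lemma wedge_nonzero:
  assumes "x $ 4 = 0" "y $ 4 = 0"
    and ind: "\<And>r s t. r *\<^sub>R x + s *\<^sub>R y + t *\<^sub>R bv 3 = 0 \<Longrightarrow> r = 0 \<and> s = 0"
  shows "x$1 * y$2 - x$2 * y$1 \<noteq> 0"
proof
  assume z: "x$1 * y$2 - x$2 * y$1 = 0"
  have "y$1 *\<^sub>R x + (- x$1) *\<^sub>R y + (x$1 * y$3 - y$1 * x$3) *\<^sub>R bv 3 = 0"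
    using z assms(1,2) by (simp add: vec_eq_iff forall_4 axis_def algebra_simps)
  then have "y$1 = 0 \<and> - x$1 = 0" by (rule ind)
  then have 1: "x$1 = 0" by simp
  have "y$2 *\<^sub>R x + (- x$2) *\<^sub>R y + (x$2 * y$3 - y$2 * x$3) *\<^sub>R bv 3 = 0"
    using z assms(1,2) by (simp add: vec_eq_iff forall_4 axis_def algebra_simps)
  then have "y$2 = 0 \<and> - x$2 = 0" by (rule ind)
  then have 2: "x$2 = 0" by simp
  have "1 *\<^sub>R x + 0 *\<^sub>R y + (- x$3) *\<^sub>R bv 3 = 0"
    using 1 2 assms(1,2) by (simp add: vec_eq_iff forall_4 axis_def)
  then have "(1::real) = 0 \<and> (0::real) = 0" by (rule ind)
  then show False by simp
qed

text \<open>Modulo the center the plane of v, Jv is the whole ideal, so the complex number by which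
  ad X acts on it has twice its real part equal to d and its squared modulus equal to
  \<Delta>.\<close>

lemma transversal_normal_form:
  assumes Jz: "J (bv 3) $ 4 \<noteq> 0"
  obtains X v q \<sigma> where "adapted J 4 X v" "\<sigma> = 1 \<or> \<sigma> = -1" "\<Delta> = (d/2)\<^sup>2 + q\<^sup>2"
    "bracket g X v = (d/2) *\<^sub>R v + q *\<^sub>R J v" "bracket g X (J v) = (d/2) *\<^sub>R J v - q *\<^sub>R v"
    "bracket g v (J v) = \<sigma> *\<^sub>R J X" "bracket g X (J X) = d *\<^sub>R J X"
    "bracket g (J X) v = 0" "bracket g (J X) (J v) = 0"
proof -
  define c where "c = J (bv 3) $ 4"
  define X where "X = (1 / c) *\<^sub>R J (bv 3)"
  have c: "c \<noteq> 0" using Jz by (simp add: c_def)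
  have JX: "J X = - (1 / c) *\<^sub>R bv 3" by (simp add: X_def J_simps)
  obtain X0 v where "adapted J 4 X0 v" using obtain_adapted .
  then have ad: "adapted J 4 X v"
    using c by (simp add: adapted_def JX) (simp add: X_def c_def axis_def)
  then have k: "X$4 = 1" "J X$4 = 0" "v$4 = 0" "J v$4 = 0" by (auto simp: adapted_def)
  have cX: "J (bv 3) = c *\<^sub>R X" using c by (simp add: X_def)
  have "c *\<^sub>R bracket g X (J v) = c *\<^sub>R J (bracket g X v)"
    using nijenhuis[of "bv 3" v] by (simp add: cX bracket_center k bracket_simps J_simps)
  then have XJv: "bracket g X (J v) = J (bracket g X v)" using c by simp
  then have "J (bracket g X v) $ 4 = 0" using bracket_4[of X "J v"] by simp
  then obtain p q where Xv: "bracket g X v = p *\<^sub>R v + q *\<^sub>R J v"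
    using adapted_plane[OF ad bracket_4] by blast
  have XJv: "bracket g X (J v) = p *\<^sub>R J v - q *\<^sub>R v" by (simp add: XJv Xv J_simps)
  define m where "m = v$1 * J v$2 - v$2 * J v$1"
  have m: "m \<noteq> 0"
    unfolding m_def
  proof (rule wedge_nonzero[OF k(3,4)])
    fix r s t assume "r *\<^sub>R v + s *\<^sub>R J v + t *\<^sub>R bv 3 = 0"
    then have "0 *\<^sub>R X + (- c * t) *\<^sub>R J X + r *\<^sub>R v + s *\<^sub>R J v = 0"
      using c by (simp add: JX ac_simps)
    then show "r = 0 \<and> s = 0"
      using adapted_independent4[OF ad] unfolding independent4_def by blast
  qed
  have B: "b11 * v$1 + b12 * v$2 = p * v$1 + q * J v$1" "b21 * v$1 + b22 * v$2 = p * v$2 + q * J v$2"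
    using bracket_12[OF k(1,3)] by (simp_all add: Xv)
  have BJ: "b11 * J v$1 + b12 * J v$2 = p * J v$1 - q * v$1" "b21 * J v$1 + b22 * J v$2 = p * J v$2 - q * v$2"
    using bracket_12[OF k(1,4)] by (simp_all add: XJv)
  have "(d - 2 * p) * m = 0" using B BJ trace m_def by algebra
  then have p: "p = d / 2" using m by simp
  have "(\<Delta> - (p\<^sup>2 + q\<^sup>2)) * m = 0" using B BJ det m_def by algebra
  then have \<Delta>: "\<Delta> = (d/2)\<^sup>2 + q\<^sup>2" using m p by simp
  define n where "n = - m * c"
  have n: "n \<noteq> 0" using m c by (simp add: n_def)
  have vJv: "bracket g v (J v) = n *\<^sub>R J X"
    using c by (simp add: bracket_nil[OF k(3,4)] m_def[symmetric] JX n_def)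
  \<comment> \<open>Scaling v by t multiplies [v, Jv] by t^2 > 0: only the modulus of n can be
    normalised, and its sign survives as \<sigma>.\<close>
  define t where "t = 1 / sqrt \<bar>n\<bar>"
  have t: "t \<noteq> 0" "t * t * n = sgn n"
    using n by (simp_all add: t_def sgn_if)
  define u where "u = t *\<^sub>R v"
  have Ju: "J u = t *\<^sub>R J v" by (simp add: u_def J_simps)
  have "adapted J 4 X u"
    using ad t by (simp add: adapted_def Ju) (simp add: u_def)
  moreover have "sgn n = 1 \<or> sgn n = -1" using n by (simp add: sgn_if)
  moreover have "bracket g X u = (d/2) *\<^sub>R u + q *\<^sub>R J u" "bracket g X (J u) = (d/2) *\<^sub>R J u - q *\<^sub>R u"
    by (simp_all add: Ju) (simp_all add: u_def bracket_simps Xv XJv p algebra_simps)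
  moreover have "bracket g u (J u) = sgn n *\<^sub>R J X"
    by (simp add: Ju) (simp add: u_def bracket_simps vJv t(2)[symmetric])
  moreover have "bracket g X (J X) = d *\<^sub>R J X" "bracket g (J X) u = 0" "bracket g (J X) (J u) = 0"
    by (simp_all add: Ju) (simp_all add: JX u_def bracket_simps bracket_center k)
  ultimately show ?thesis using that \<Delta> by blast
qed

lemma tangential_normal_form:
  assumes Jz: "J (bv 3) $ 4 = 0" and d: "d \<noteq> 0"
  defines "z \<equiv> bv 3"
  obtains X \<kappa> where "adapted J 4 X z" "\<kappa> = d \<or> \<kappa> = - d \<or> \<kappa> = 2 * d" "\<kappa> * (d - \<kappa>) = \<Delta>"
    "bracket g X z = d *\<^sub>R z" "bracket g X (J z) = (d - \<kappa>) *\<^sub>R J z" "bracket g X (J X) = \<kappa> *\<^sub>R J X"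
    "bracket g (J X) z = 0" "bracket g (J X) (J z) = \<kappa> *\<^sub>R z" "bracket g z (J z) = 0"
proof -
  obtain X v where "adapted J 4 X v" using obtain_adapted .
  moreover have "z \<noteq> 0" by (simp add: z_def axis_eq_0_iff)
  ultimately have ad: "adapted J 4 X z"
    using Jz by (simp add: adapted_def z_def axis_def)
  then have k: "X$4 = 1" "J X$4 = 0" "z$4 = 0" "J z$4 = 0" by (auto simp: adapted_def)
  note ce = bracket_center[folded z_def]
  define \<kappa> where "\<kappa> = J X$1 * J z$2 - J X$2 * J z$1"
  have YJz: "bracket g (J X) (J z) = \<kappa> *\<^sub>R z"
    using bracket_nil[OF k(2,4)] unfolding \<kappa>_def z_def .
  \<comment> \<open>Integrability for X and e_3, where [JX, z] = 0 by centrality.\<close>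
  have "\<kappa> *\<^sub>R z = d *\<^sub>R z + J (bracket g X (J z))"
    using nijenhuis[of X z] by (simp add: YJz ce k J_simps)
  then have "J (\<kappa> *\<^sub>R z) = J (d *\<^sub>R z + J (bracket g X (J z)))" by simp
  then have XJz: "bracket g X (J z) = (d - \<kappa>) *\<^sub>R J z" by (simp add: J_simps algebra_simps)
  have \<kappa>: "\<kappa> \<noteq> 0"
    unfolding \<kappa>_def
  proof (rule wedge_nonzero[OF k(2,4)])
    fix r s t assume "r *\<^sub>R J X + s *\<^sub>R J z + t *\<^sub>R bv 3 = 0"
    then have "0 *\<^sub>R X + r *\<^sub>R J X + t *\<^sub>R z + s *\<^sub>R J z = 0"
      by (simp add: z_def ac_simps)
    then show "r = 0 \<and> s = 0"
      using adapted_independent4[OF ad] unfolding independent4_def by blast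
  qed
  obtain r \<beta> \<alpha> where XY: "bracket g X (J X) = r *\<^sub>R J X + \<beta> *\<^sub>R z + \<alpha> *\<^sub>R J z"
    using adapted_hyperplane[OF ad bracket_4] .
  have B: "b11 * J X$1 + b12 * J X$2 = r * J X$1 + \<alpha> * J z$1" "b21 * J X$1 + b22 * J X$2 = r * J X$2 + \<alpha> * J z$2"
    using bracket_12[OF k(1,2)] by (simp_all add: XY) (simp_all add: z_def axis_def)
  have BJ: "b11 * J z$1 + b12 * J z$2 = (d - \<kappa>) * J z$1" "b21 * J z$1 + b22 * J z$2 = (d - \<kappa>) * J z$2"
    using bracket_12[OF k(1,4)] by (simp_all add: XJz)
  \<comment> \<open>In the basis JX, Jz modulo the center, b is triangular with diagonal r, d -
    \<kappa>. Its trace gives r = \<kappa> and its determinant gives \<Delta>.\<close>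
  have "(r - \<kappa>) * \<kappa> = 0" using B BJ trace \<kappa>_def by algebra
  then have r: "r = \<kappa>" using \<kappa> by simp
  have "(\<Delta> - \<kappa> * (d - \<kappa>)) * \<kappa> = 0" using B BJ det \<kappa>_def r by algebra
  then have \<Delta>: "\<kappa> * (d - \<kappa>) = \<Delta>" using \<kappa> by simp
  \<comment> \<open>The values of \<omega>(z, .) on Jz, X and JX, not all zero. Closedness yields
    \<kappa> = 2d if e is nonzero; otherwise a nonzero f gives \<kappa> = -d and a nonzero s gives
    \<kappa> = d.\<close>
  define e s f where "e = \<omega> z (J z)" and "s = \<omega> z X" and "f = \<omega> z (J X)"
  have w: "\<omega> z (J z) = e" "\<omega> (J z) z = - e" "\<omega> z X = s" "\<omega> z (J X) = f" "\<omega> (J X) z = - f"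
    "\<omega> (J z) (J X) = s" "\<omega> (J X) (J z) = - s"
    using \<omega>_swap[of "J z" z] \<omega>_swap[of "J X" z] \<omega>_J[of z X] \<omega>_J[of X z] \<omega>_swap[of X z]
    by (simp_all add: e_def s_def f_def)
  have sw: "bracket g z X = - bracket g X z" "bracket g (J z) X = - bracket g X (J z)"
    by (rule bracket_swap)+
  have zJz: "bracket g z (J z) = 0" "bracket g (J X) z = 0" "bracket g z (J X) = 0" "bracket g X z = d *\<^sub>R z"
    using k by (simp_all add: ce)
  have "(2 * d - \<kappa>) * e = 0"
    using closed[of X z "J z"] by (simp add: zJz sw XJz \<omega>_simps w algebra_simps)
  moreover have "(\<kappa> + d) * f + \<alpha> * e = 0"
    using closed[of X "J X" z] by (simp add: zJz sw XJz XY r \<omega>_simps w algebra_simps)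
  moreover have "\<beta> * e = (d - \<kappa>) * s"
    using closed[of X "J X" "J z"] by (simp add: zJz sw XJz XY YJz r \<omega>_simps w algebra_simps)
  moreover have "\<not> (e = 0 \<and> s = 0 \<and> f = 0)"
    using \<omega>_zero_adapted[OF ad, of z] \<open>z \<noteq> 0\<close> w by (auto simp: \<omega>_self)
  ultimately have \<kappa>d: "\<kappa> = d \<or> \<kappa> = - d \<or> \<kappa> = 2 * d" by auto
  then have \<kappa>2: "2 * \<kappa> - d \<noteq> 0" using d by auto
  \<comment> \<open>Shifting X by \<rho> z + \<tau> Jz makes JX' an eigenvector. The divisor
    2\<kappa> - d is the difference of the eigenvalues \<kappa> and d - \<kappa>; it takes the
    values d, -3d, 3d.\<close>
  define \<rho> \<tau> where "\<rho> = \<alpha> / (2 * \<kappa> - d)" and "\<tau> = \<beta> / d"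
  have \<alpha>: "\<alpha> = \<rho> * (2 * \<kappa> - d)" and \<beta>: "\<beta> = \<tau> * d" using \<kappa>2 d by (simp_all add: \<rho>_def \<tau>_def)
  define X' where "X' = X + \<rho> *\<^sub>R z + \<tau> *\<^sub>R J z"
  have JX': "J X' = J X + \<rho> *\<^sub>R J z - \<tau> *\<^sub>R z" by (simp add: X'_def J_simps)
  have JzJX: "bracket g (J z) (J X) = - \<kappa> *\<^sub>R z" "bracket g (J z) z = 0"
    using bracket_swap[of g "J z" "J X"] bracket_swap[of g "J z" z] YJz zJz by simp_all
  have "adapted J 4 X' z" unfolding X'_def by (rule adapted_shift[OF ad])
  moreover have "bracket g X' z = d *\<^sub>R z" "bracket g X' (J z) = (d - \<kappa>) *\<^sub>R J z"
    "bracket g (J X') z = 0" "bracket g (J X') (J z) = \<kappa> *\<^sub>R z" "bracket g z (J z) = 0"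
    by (simp_all add: JX') (simp_all add: X'_def bracket_simps zJz XJz YJz JzJX)
  moreover have "bracket g X' (J X') = \<kappa> *\<^sub>R J X'"
    unfolding JX'
    by (simp add: X'_def bracket_simps zJz XJz YJz JzJX XY r \<alpha> \<beta> vec_eq_iff algebra_simps)
  ultimately show ?thesis using that \<kappa>d \<Delta> by blast
qed

end

section \<open>The individual extensions of the Heisenberg algebra\<close>

context pseudo_kahler
begin

lemma not_D4: "g \<noteq> D4"
proof
  assume G: "g = D4"
  interpret heis_extension g J \<omega> 1 0 0 "-1" 0 "-1"
    by (intro heis_extension.intro heis_extension_axioms.intro pseudo_kahler_axioms)
      (simp_all add: G coord_simps algebra_simps)
  show False using trace_det_nonzero by simp
qed

lemma not_H4: "g \<noteq> H4"
proof
  assume G: "g = H4"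
  interpret heis_extension g J \<omega> "1/2" 1 0 "1/2" 1 "1/4"
    by (intro heis_extension.intro heis_extension_axioms.intro pseudo_kahler_axioms)
      (simp_all add: G coord_simps algebra_simps)
  show False
  proof (cases "J (bv 3) $ 4 = 0")
    case True
    then obtain X \<kappa> where "\<kappa> = 1 \<or> \<kappa> = - 1 \<or> \<kappa> = 2 * (1::real)" "\<kappa> * (1 - \<kappa>) = 1/4"
      by (rule tangential_normal_form) auto
    then show False by auto
  next
    case False
    then obtain X v q \<sigma> where ad: "adapted J 4 X v" and \<sigma>: "\<sigma> = 1 \<or> \<sigma> = (-1::real)"
      and q: "1/4 = (1/2)\<^sup>2 + q\<^sup>2"
      and br: "bracket g X v = (1/2) *\<^sub>R v + q *\<^sub>R J v" "bracket g X (J v) = (1/2) *\<^sub>R J v - q *\<^sub>R v"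
        "bracket g v (J v) = \<sigma> *\<^sub>R J X"
      by (rule transversal_normal_form)
    have q0: "q = 0" using q by (simp add: power2_eq_square)
    have k: "X$4 = 1" "J X$4 = 0" "v$4 = 0" "J v$4 = 0" using ad by (auto simp: adapted_def)
    \<comment> \<open>With q = 0, ad X would be the scalar 1/2 modulo the center, but b is a Jordan
      block. So v and Jv lie in its eigenline and commute.\<close>
    have "v$2 = 0" using bracket_12(1)[OF k(1,3)] by (simp add: br q0)
    moreover have "J v$2 = 0" using bracket_12(1)[OF k(1,4)] by (simp add: br q0)
    ultimately have "\<sigma> *\<^sub>R J X = 0" using br(3) bracket_nil[OF k(3,4)] by simp
    then have "J X = 0" using \<sigma> by auto
    then have "J (J X) = 0" by (simp add: J_simps)
    then show False using k by (simp add: J_J)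
  qed
qed

lemma D4_lam_equivalent:
  assumes G: "g = D4_lam l" and valid: "valid_params g"
  shows "\<exists>J' \<Omega>. kahler_list g J' \<Omega> \<and> equivalent_cs (bracket g) J J'"
proof -
  have l: "l \<ge> 1/2" using valid G by simp
  interpret heis_extension g J \<omega> l 0 0 "1 - l" 1 "l * (1 - l)"
    by (intro heis_extension.intro heis_extension_axioms.intro pseudo_kahler_axioms)
      (simp_all add: G coord_simps algebra_simps)
  show ?thesis
  proof (cases "J (bv 3) $ 4 = 0")
    case True
    define z where "z = (bv 3 :: real^4)"
    obtain X \<kappa> where ad: "adapted J 4 X z" and \<kappa>: "\<kappa> = 1 \<or> \<kappa> = - 1 \<or> \<kappa> = 2 * (1::real)"
      and kl: "\<kappa> * (1 - \<kappa>) = l * (1 - l)"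
      and br: "bracket g X z = 1 *\<^sub>R z" "bracket g X (J z) = (1 - \<kappa>) *\<^sub>R J z" "bracket g X (J X) = \<kappa> *\<^sub>R J X"
        "bracket g (J X) z = 0" "bracket g (J X) (J z) = \<kappa> *\<^sub>R z" "bracket g z (J z) = 0"
      unfolding z_def by (rule tangential_normal_form[OF True]) auto
    have br': "bracket g z X = - z" "bracket g (J z) X = (\<kappa> - 1) *\<^sub>R J z" "bracket g (J X) X = - \<kappa> *\<^sub>R J X"
        "bracket g z (J X) = 0" "bracket g (J z) (J X) = - \<kappa> *\<^sub>R z" "bracket g (J z) z = 0"
      using bracket_swap[of g z X] bracket_swap[of g "J z" X] bracket_swap[of g "J X" X]
        bracket_swap[of g z "J X"] bracket_swap[of g "J z" "J X"] bracket_swap[of g "J z" z] br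
      by (simp_all add: algebra_simps)
    note ind = adapted_independent4[OF ad]
    have i1: "independent4 (J X) (J z) z X"
      using independent4_swap(2)[OF independent4_swap(3)[OF independent4_swap(2)[OF independent4_swap(1)[OF ind]]]] .
    \<comment> \<open>\<kappa>(1 - \<kappa>) is 0 for \<kappa> = 1 and -2 for the other two values,
      both of which mean l = 2; hence \<open>D4_lam 2\<close> occurs with two structures.\<close>
    consider "\<kappa> = 1" | "\<kappa> = -1" | "\<kappa> = 2" using \<kappa> by auto
    then show ?thesis
    proof cases
      case 1
      then have "l * (1 - l) = 0" using kl by simp
      then have l1: "l = 1" using l by simp
      let ?Y = "(-1) *\<^sub>R J X" and ?w = "(-1) *\<^sub>R J z" and ?z = "1 *\<^sub>R z" and ?X = "1 *\<^sub>R X"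
      have i: "independent4 ?Y ?w ?z ?X" by (rule independent4_scale[OF i1]) auto
      have b: "bracket g ?Y ?w = z" "bracket g ?Y ?z = 0" "bracket g ?Y ?X = J X"
        "bracket g ?w ?z = 0" "bracket g ?w ?X = 0" "bracket g ?z ?X = - z"
        by (simp_all add: bracket_simps br br' 1)
      have j: "J ?Y = X" "J ?w = z" "J ?z = J z" "J ?X = J X" by (simp_all add: J_simps)
      have "equivalent_cs (bracket g) J (cs_ext [(1, 1, 4), (2, 1, 3)])"
        by (rule equivalent_csI'[OF linear_J linear_cs_ext i b j])
          (simp_all add: G l1 frame_def coord_simps)
      then show ?thesis using G l1 kahler_list.d4_1 by blast
    next
      case 2
      then have "(l - 2) * (l + 1) = 0" using kl by (simp add: algebra_simps)
      then have l2: "l = 2" using l by auto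
      \<comment> \<open>Jz has eigenvalue 2 and JX has eigenvalue -1, so Jz comes first
        here.\<close>
      let ?Y = "(-1) *\<^sub>R J X" and ?w = "(-1) *\<^sub>R J z" and ?z = "1 *\<^sub>R z" and ?X = "1 *\<^sub>R X"
      have i: "independent4 ?w ?Y ?z ?X"
        by (rule independent4_scale[OF independent4_swap(1)[OF i1]]) auto
      have b: "bracket g ?w ?Y = z" "bracket g ?w ?z = 0" "bracket g ?w ?X = 2 *\<^sub>R J z"
        "bracket g ?Y ?z = 0" "bracket g ?Y ?X = - J X" "bracket g ?z ?X = - z"
        by (simp_all add: bracket_simps br br' 2)
      have j: "J ?w = z" "J ?Y = X" "J ?z = J z" "J ?X = J X" by (simp_all add: J_simps)
      have "equivalent_cs (bracket g) J (cs_ext [(4, -1, 2), (1, 1, 3)])"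
        by (rule equivalent_csI'[OF linear_J linear_cs_ext i b j])
          (simp_all add: G l2 frame_def coord_simps)
      then show ?thesis using G l2 kahler_list.d4_2_a by blast
    next
      case 3
      then have "(l - 2) * (l + 1) = 0" using kl by (simp add: algebra_simps)
      then have l2: "l = 2" using l by auto
      \<comment> \<open>[JX, Jz] = 2z calls for the factor 1/2, the origin of the 2 in J e_4 = -2
        e_1.\<close>
      let ?Y = "(-1/2) *\<^sub>R J X" and ?w = "(-1) *\<^sub>R J z" and ?z = "1 *\<^sub>R z" and ?X = "1 *\<^sub>R X"
      have i: "independent4 ?Y ?w ?z ?X" by (rule independent4_scale[OF i1]) auto
      have b: "bracket g ?Y ?w = z" "bracket g ?Y ?z = 0" "bracket g ?Y ?X = J X"
        "bracket g ?w ?z = 0" "bracket g ?w ?X = - J z" "bracket g ?z ?X = - z"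
        by (simp_all add: bracket_simps br br' 3)
      have j: "J ?Y = (1/2) *\<^sub>R X" "J ?w = z" "J ?z = J z" "J ?X = J X" by (simp_all add: J_simps)
      have "equivalent_cs (bracket g) J (cs_ext [(4, -2, 1), (2, 1, 3)])"
        by (rule equivalent_csI'[OF linear_J linear_cs_ext i b j])
          (simp_all add: G l2 frame_def coord_simps)
      then show ?thesis using G l2 kahler_list.d4_2_b by blast
    qed
  next
    case False
    then obtain X v q \<sigma> where ad: "adapted J 4 X v" and \<sigma>: "\<sigma> = 1 \<or> \<sigma> = (-1::real)"
      and q: "l * (1 - l) = (1/2)\<^sup>2 + q\<^sup>2"
      and br: "bracket g X v = (1/2) *\<^sub>R v + q *\<^sub>R J v" "bracket g X (J v) = (1/2) *\<^sub>R J v - q *\<^sub>R v"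
        "bracket g v (J v) = \<sigma> *\<^sub>R J X" "bracket g X (J X) = 1 *\<^sub>R J X"
        "bracket g (J X) v = 0" "bracket g (J X) (J v) = 0"
      by (rule transversal_normal_form)
    \<comment> \<open>Completing the square: l(1 - l) never exceeds 1/4.\<close>
    have "(l - 1/2)\<^sup>2 + q\<^sup>2 = 0" using q by (simp add: power2_eq_square algebra_simps)
    then have lq: "l = 1/2" "q = 0" by (simp_all add: sum_power2_eq_zero_iff)
    have \<sigma>\<sigma>: "\<sigma> * \<sigma> = 1" "\<sigma> \<noteq> 0" using \<sigma> by auto
    have br': "bracket g v X = - (1/2) *\<^sub>R v" "bracket g (J v) X = - (1/2) *\<^sub>R J v"
        "bracket g (J X) X = - J X" "bracket g v (J X) = 0" "bracket g (J v) (J X) = 0"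
      using bracket_swap[of g v X] bracket_swap[of g "J v" X] bracket_swap[of g "J X" X]
        bracket_swap[of g v "J X"] bracket_swap[of g "J v" "J X"] br lq
      by simp_all
    note ind = adapted_independent4[OF ad]
    let ?v = "1 *\<^sub>R v" and ?w = "\<sigma> *\<^sub>R J v" and ?Y = "1 *\<^sub>R J X" and ?X = "1 *\<^sub>R X"
    have "independent4 v (J v) (J X) X"
      using independent4_swap(2)[OF independent4_swap(1)[OF independent4_swap(3)[OF
          independent4_swap(2)[OF independent4_swap(1)[OF ind]]]]] .
    then have i: "independent4 ?v ?w ?Y ?X" by (rule independent4_scale) (use \<sigma>\<sigma> in auto)
    have b: "bracket g ?v ?w = J X" "bracket g ?v ?Y = 0" "bracket g ?v ?X = - (1/2) *\<^sub>R v"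
      "bracket g ?w ?Y = 0" "bracket g ?w ?X = - (1/2) *\<^sub>R ?w" "bracket g ?Y ?X = - J X"
      by (simp_all add: bracket_simps br br' \<sigma>\<sigma>)
    have j: "J ?v = \<sigma> *\<^sub>R ?w" "J ?w = - \<sigma> *\<^sub>R v" "J ?Y = - X" "J ?X = J X" by (simp_all add: J_simps \<sigma>\<sigma>)
    have "equivalent_cs (bracket g) J (cs_ext [(4, 1, 3), (1, \<sigma>, 2)])"
      by (rule equivalent_csI'[OF linear_J linear_cs_ext i b j])
        (use \<sigma> in \<open>auto simp add: G lq frame_def coord_simps\<close>)
    moreover have "cs_ext [(4, 1, 3), (1, \<sigma>, 2)] \<in> {cs_ext [(4, 1, 3), (1, 1, 2)], cs_ext [(4, 1, 3), (1, -1, 2)]}"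
      using \<sigma> by auto
    ultimately show ?thesis using G lq kahler_list.d4_half by blast
  qed
qed

lemma D4'_del_equivalent:
  assumes G: "g = D4'_del \<delta>" and valid: "valid_params g"
  shows "\<exists>J' \<Omega>. kahler_list g J' \<Omega> \<and> equivalent_cs (bracket g) J J'"
proof -
  have \<delta>0: "\<delta> \<ge> 0" using valid G by simp
  interpret heis_extension g J \<omega> "\<delta>/2" 1 "-1" "\<delta>/2" \<delta> "(\<delta>/2)\<^sup>2 + 1"
    by (intro heis_extension.intro heis_extension_axioms.intro pseudo_kahler_axioms)
      (simp_all add: G coord_simps algebra_simps power2_eq_square)
  have pos: "(\<delta>/2)\<^sup>2 + 1 > 0" using zero_le_power2[of "\<delta>/2"] by linarith
  \<comment> \<open>Excludes \<delta> = 0, where the trace is 0 and the determinant is 1.\<close>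
  then have \<delta>: "\<delta> \<noteq> 0" using trace_det_nonzero by auto
  show ?thesis
  proof (cases "J (bv 3) $ 4 = 0")
    case True
    then obtain X \<kappa> where \<kappa>: "\<kappa> = \<delta> \<or> \<kappa> = - \<delta> \<or> \<kappa> = 2 * \<delta>" and e: "\<kappa> * (\<delta> - \<kappa>) = (\<delta>/2)\<^sup>2 + 1"
      by (rule tangential_normal_form[OF _ \<delta>]) auto
    \<comment> \<open>None of the three values of \<kappa> makes the determinant positive.\<close>
    have "\<kappa> * (\<delta> - \<kappa>) = 0 \<or> \<kappa> * (\<delta> - \<kappa>) = - 2 * \<delta>\<^sup>2"
      using \<kappa> by (auto simp: power2_eq_square algebra_simps)
    then have False using e pos zero_le_power2[of \<delta>] by linarith
    then show ?thesis ..
  next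
    case False
    then obtain X v q \<sigma> where ad: "adapted J 4 X v" and \<sigma>: "\<sigma> = 1 \<or> \<sigma> = (-1::real)"
      and q: "(\<delta>/2)\<^sup>2 + 1 = (\<delta>/2)\<^sup>2 + q\<^sup>2"
      and br: "bracket g X v = (\<delta>/2) *\<^sub>R v + q *\<^sub>R J v" "bracket g X (J v) = (\<delta>/2) *\<^sub>R J v - q *\<^sub>R v"
        "bracket g v (J v) = \<sigma> *\<^sub>R J X" "bracket g X (J X) = \<delta> *\<^sub>R J X"
        "bracket g (J X) v = 0" "bracket g (J X) (J v) = 0"
      by (rule transversal_normal_form)
    have q: "q = 1 \<or> q = -1" using q by (simp add: power2_eq_1_iff)
    \<comment> \<open>With e_2 = \<eta> Jv the rotation part of ad X gets the sign of the table;
      then [e_1, e_2] = \<epsilon> JX has to be e_3. The two signs remain in J e_1 = \<eta> e_2 and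
      J e_4 = \<epsilon> e_3, which gives the four structures.\<close>
    define \<eta> \<epsilon> where "\<eta> = - q" and "\<epsilon> = \<eta> * \<sigma>"
    have \<eta>: "\<eta> = 1 \<or> \<eta> = -1" "q = - \<eta>" and \<epsilon>: "\<epsilon> = 1 \<or> \<epsilon> = -1"
      using q \<sigma> by (auto simp: \<eta>_def \<epsilon>_def)
    have sq: "\<eta> * \<eta> = 1" "\<epsilon> * \<epsilon> = 1" "\<eta> \<noteq> 0" "\<epsilon> \<noteq> 0" using \<eta> \<epsilon> by auto
    have br': "bracket g v X = - (\<delta>/2) *\<^sub>R v + \<eta> *\<^sub>R J v" "bracket g (J v) X = - (\<delta>/2) *\<^sub>R J v - \<eta> *\<^sub>R v"
        "bracket g (J X) X = - \<delta> *\<^sub>R J X" "bracket g v (J X) = 0" "bracket g (J v) (J X) = 0"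
      using bracket_swap[of g v X] bracket_swap[of g "J v" X] bracket_swap[of g "J X" X]
        bracket_swap[of g v "J X"] bracket_swap[of g "J v" "J X"] br
      by (simp_all add: \<eta>(2))
    note ind = adapted_independent4[OF ad]
    let ?v = "1 *\<^sub>R v" and ?w = "\<eta> *\<^sub>R J v" and ?Y = "\<epsilon> *\<^sub>R J X" and ?X = "1 *\<^sub>R X"
    have "independent4 v (J v) (J X) X"
      using independent4_swap(2)[OF independent4_swap(1)[OF independent4_swap(3)[OF
          independent4_swap(2)[OF independent4_swap(1)[OF ind]]]]] .
    then have i: "independent4 ?v ?w ?Y ?X" by (rule independent4_scale) (use sq in auto)
    have b: "bracket g ?v ?w = ?Y" "bracket g ?v ?Y = 0" "bracket g ?v ?X = - (\<delta>/2) *\<^sub>R v + ?w"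
      "bracket g ?w ?Y = 0" "bracket g ?w ?X = - (\<delta>/2) *\<^sub>R ?w - v" "bracket g ?Y ?X = - \<delta> *\<^sub>R ?Y"
      using sq by (simp_all add: bracket_simps br br' \<epsilon>_def algebra_simps)
    have j: "J ?v = \<eta> *\<^sub>R ?w" "J ?w = - \<eta> *\<^sub>R v" "J ?Y = - \<epsilon> *\<^sub>R X" "J ?X = \<epsilon> *\<^sub>R ?Y"
      by (simp_all add: J_simps sq)
    have "equivalent_cs (bracket g) J (cs_ext [(4, \<epsilon>, 3), (1, \<eta>, 2)])"
      by (rule equivalent_csI'[OF linear_J linear_cs_ext i b j])
        (use \<eta>(1) \<epsilon> in \<open>auto simp add: G frame_def coord_simps\<close>)
    moreover have "cs_ext [(4, \<epsilon>, 3), (1, \<eta>, 2)] \<in> {cs_ext [(4, 1, 3), (1, 1, 2)], cs_ext [(4, -1, 3), (1, 1, 2)],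
         cs_ext [(4, -1, 3), (1, -1, 2)], cs_ext [(4, 1, 3), (1, -1, 2)]}"
      using \<eta>(1) \<epsilon> by auto
    ultimately show ?thesis using G kahler_list.d4'[OF \<delta>0 \<delta>] by blast
  qed
qed

end

section \<open>Products and complexifications of the affine algebra\<close>

lemma two_form_bv:
  "two_form a b c d e f (bv 1) x = a * x$2 + b * x$3 + c * x$4"
  "two_form a b c d e f (bv 2) x = - a * x$1 + d * x$3 + e * x$4"
  "two_form a b c d e f (bv 3) x = - b * x$1 - d * x$2 + f * x$4"
  "two_form a b c d e f (bv 4) x = - c * x$1 - e * x$2 - f * x$3"
  by (simp_all add: two_form_def ee_def axis_def algebra_simps)

lemma bv_nth: "bv i $ j = (if j = i then 1 else 0)"
  by (simp add: axis_def)

context pseudo_kahler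
begin

lemma J_expand: "J x = x$1 *\<^sub>R J (bv 1) + x$2 *\<^sub>R J (bv 2) + x$3 *\<^sub>R J (bv 3) + x$4 *\<^sub>R J (bv 4)"
proof -
  have "J x = J (x$1 *\<^sub>R bv 1 + x$2 *\<^sub>R bv 2 + x$3 *\<^sub>R bv 3 + x$4 *\<^sub>R bv 4)"
    using vec4_expand[of x] by simp
  then show ?thesis by (simp add: J_simps)
qed

lemma J_uminus_flip: "J u = - w \<Longrightarrow> J w = u"
  using J_J[of u] by (simp add: J_simps)

lemma J_J_component:
  "J x $ 1 * J (bv 1) $ i + J x $ 2 * J (bv 2) $ i + J x $ 3 * J (bv 3) $ i + J x $ 4 * J (bv 4) $ i = - x $ i"
  using J_J[of x] J_expand[of "J x"] by (simp add: vec_eq_iff)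

lemma obtain_two_form:
  obtains a b c d e f where "\<omega> = two_form a b c d e f" "a * f - b * e + c * d \<noteq> 0"
proof -
  obtain a b c d e f where w: "\<omega> = two_form a b c d e f"
    using alternating_eq_two_form[OF bilinear_\<omega>] \<omega>_self by blast
  moreover have "a * f - b * e + c * d \<noteq> 0"
    using nondegenerate two_form_nondegenerate_iff[of a b c d e f] unfolding w by blast
  ultimately show ?thesis using that by blast
qed

text \<open>J is shown to preserve both factors: J e_2 lies in the span of e_1, e_2 and J e_4 in
  that of e_3, e_4.\<close>

lemma R2R2_equivalent:
  assumes G: "g = R2R2"
  shows "\<exists>J' \<Omega>. kahler_list g J' \<Omega> \<and> equivalent_cs (bracket g) J J'"
proof -
  have br: "bracket g x y = (x$1 * y$2 - x$2 * y$1) *\<^sub>R bv 2 + (x$3 * y$4 - x$4 * y$3) *\<^sub>R bv 4" for x y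
    by (simp add: G coord_simps)
  obtain a b c d e f where w: "\<omega> = two_form a b c d e f" and pf: "a * f - b * e + c * d \<noteq> 0"
    by (rule obtain_two_form)
  have "d = 0" "e = 0" "c = 0"
    using closed[of "bv 1" "bv 2" "bv 3"] closed[of "bv 1" "bv 2" "bv 4"] closed[of "bv 1" "bv 3" "bv 4"]
    by (simp_all add: br axis_def bilinear_lzero[OF bilinear_two_form] bilinear_lneg[OF bilinear_two_form] w)
      (simp_all add: two_form_def ee_def axis_def)
  then have af: "a \<noteq> 0" "f \<noteq> 0" using pf by auto
  define P where "P = J (bv 2)"
  define Q where "Q = J (bv 4)"
  \<comment> \<open>Compatibility links the mixed entries: as a and f are nonzero,
    \<open>P$3\<close> and \<open>Q$1\<close> vanish together.\<close>
  have "\<omega> P (bv 4) = \<omega> Q (bv 2)"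
    using \<omega>_J_left[of "bv 2" "bv 4"] \<omega>_swap[of "bv 2" Q] by (simp add: P_def Q_def)
  then have C: "f * P$3 = a * Q$1"
    by (simp add: w two_form_def ee_def axis_def \<open>c = 0\<close> \<open>d = 0\<close> \<open>e = 0\<close>)
  have PQ: "bracket g P Q = P$3 *\<^sub>R Q - Q$1 *\<^sub>R P"
    using nijenhuis[of "bv 2" "bv 4"]
    unfolding P_def[symmetric] Q_def[symmetric]
    by (simp add: br[of "bv 2" "bv 4"] br[of P "bv 4"] br[of "bv 2" Q] bv_nth J_simps)
      (simp add: P_def[symmetric] Q_def[symmetric])
  have N: "P$3 * Q$1 = Q$1 * P$1" "P$1 * Q$2 - P$2 * Q$1 = P$3 * Q$2 - Q$1 * P$2"
    "P$3 * Q$3 = Q$1 * P$3" "P$3 * Q$4 - P$4 * Q$3 = P$3 * Q$4 - Q$1 * P$4"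
    using PQ unfolding br by (simp_all add: vec_eq_iff forall_4 bv_nth)
  \<comment> \<open>Otherwise J e_2 lies in [g, g], and the e_2-component of integrability for e_1,
    e_2 reads \<open>P$2 * P$2 = - 1\<close>.\<close>
  have P0: "\<not> (P$1 = 0 \<and> P$3 = 0)"
  proof
    assume z: "P$1 = 0 \<and> P$3 = 0"
    define y where "y = J (bv 1)"
    have "bracket g y P = bv 2 + y$1 *\<^sub>R P + P$2 *\<^sub>R P"
      using nijenhuis[of "bv 1" "bv 2"] z
      unfolding P_def[symmetric] y_def[symmetric]
      by (simp add: br[of "bv 1" "bv 2"] br[of y "bv 2"] br[of "bv 1" P] bv_nth J_simps)
        (simp add: P_def[symmetric])
    then have "bracket g y P $ 2 = (bv 2 + y$1 *\<^sub>R P + P$2 *\<^sub>R P) $ 2" by simp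
    then have "P$2 * P$2 = - 1" using z by (simp add: br bv_nth)
    then show False using zero_le_square[of "P$2"] by linarith
  qed
  have Q0: "\<not> (Q$1 = 0 \<and> Q$3 = 0)"
  proof
    assume z: "Q$1 = 0 \<and> Q$3 = 0"
    define y where "y = J (bv 3)"
    have "bracket g y Q = bv 4 + y$3 *\<^sub>R Q + Q$4 *\<^sub>R Q"
      using nijenhuis[of "bv 3" "bv 4"] z
      unfolding Q_def[symmetric] y_def[symmetric]
      by (simp add: br[of "bv 3" "bv 4"] br[of y "bv 4"] br[of "bv 3" Q] bv_nth J_simps)
        (simp add: Q_def[symmetric])
    then have "bracket g y Q $ 4 = (bv 4 + y$3 *\<^sub>R Q + Q$4 *\<^sub>R Q) $ 4" by simp
    then have "Q$4 * Q$4 = - 1" using z by (simp add: br bv_nth)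
    then show False using zero_le_square[of "Q$4"] by linarith
  qed
  have Q1: "Q$1 = 0"
  proof (rule ccontr)
    assume q: "Q$1 \<noteq> 0"
    then have p: "P$3 \<noteq> 0" using C af by auto
    have e: "P$3 = P$1" "Q$3 = Q$1" using N q p by auto
    \<comment> \<open>Chosen so that v and Jv both lie in [g, g]; J^2 v = -v in coordinates then
      gives a vanishing sum of squares.\<close>
    define v where "v = Q$1 *\<^sub>R bv 2 - P$1 *\<^sub>R bv 4"
    have Jv: "J v = Q$1 *\<^sub>R P - P$1 *\<^sub>R Q" by (simp add: v_def J_simps P_def Q_def)
    define s t where "s = J v $ 2" and "t = J v $ 4"
    have st: "s = Q$1 * P$2 - P$1 * Q$2" "t = Q$1 * P$4 - P$1 * Q$4" by (simp_all add: s_def t_def Jv)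
    have "J v $ 1 = 0" "J v $ 3 = 0" by (simp_all add: Jv e)
    then have "s * P$1 + t * Q$1 = 0" "s * P$2 + t * Q$2 = - Q$1"
      using J_J_component[of v 1] J_J_component[of v 2]
      by (simp_all add: s_def t_def P_def Q_def) (simp_all add: v_def bv_nth Q_def)
    then have "s * s + Q$1 * Q$1 = 0" using st by algebra
    then show False using q by (simp add: sum_squares_eq_zero_iff)
  qed
  then have P3: "P$3 = 0" using C af by simp
  have nz: "P$1 \<noteq> 0" "Q$3 \<noteq> 0" using P0 Q0 Q1 P3 by auto
  have z: "Q$2 = 0" "P$4 = 0" using N Q1 P3 nz by auto
  \<comment> \<open>u_2 is scaled so that -J u_2, taken as u_1, has e_1-coordinate 1; likewise in
    the other factor.\<close>
  let ?u1 = "bv 1 + (P$2 / P$1) *\<^sub>R bv 2" and ?u2 = "(- 1 / P$1) *\<^sub>R bv 2"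
    and ?u3 = "bv 3 + (Q$4 / Q$3) *\<^sub>R bv 4" and ?u4 = "(- 1 / Q$3) *\<^sub>R bv 4"
  have i: "independent4 ?u1 ?u2 ?u3 ?u4"
    unfolding independent4_def
  proof (intro allI impI)
    fix p q r s assume "p *\<^sub>R ?u1 + q *\<^sub>R ?u2 + r *\<^sub>R ?u3 + s *\<^sub>R ?u4 = 0"
    then have "(p *\<^sub>R ?u1 + q *\<^sub>R ?u2 + r *\<^sub>R ?u3 + s *\<^sub>R ?u4) $ i = 0" for i by simp
    from this[of 1] this[of 2] this[of 3] this[of 4] show "p = 0 \<and> q = 0 \<and> r = 0 \<and> s = 0"
      using nz by (simp add: bv_nth)
  qed
  have b: "bracket g ?u1 ?u2 = ?u2" "bracket g ?u1 ?u3 = 0" "bracket g ?u1 ?u4 = 0"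
    "bracket g ?u2 ?u3 = 0" "bracket g ?u2 ?u4 = 0" "bracket g ?u3 ?u4 = ?u4"
    by (simp_all add: br vec_eq_iff forall_4 bv_nth)
  have j2: "J ?u2 = - ?u1"
    using nz by (simp add: J_simps P_def[symmetric] vec_eq_iff forall_4 bv_nth z P3)
  have j4: "J ?u4 = - ?u3"
    using nz by (simp add: J_simps Q_def[symmetric] vec_eq_iff forall_4 bv_nth z Q1)
  have j1: "J ?u1 = ?u2" and j3: "J ?u3 = ?u4"
    using J_uminus_flip[OF j2] J_uminus_flip[OF j4] by blast+
  have "equivalent_cs (bracket g) J (cs_ext [(1, 1, 2), (3, 1, 4)])"
    by (rule equivalent_csI'[OF linear_J linear_cs_ext i b j1 j2 j3 j4])
      (simp_all add: G frame_def coord_simps)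
  then show ?thesis using G kahler_list.r2r2 by blast
qed

text \<open>The algebra is the complex affine algebra seen as a real one, with i e_1 = e_2 and i e_3
  = e_4. The determinant that splits the proof tells whether J[g, g] is transversal to
  [g, g].\<close>

lemma R2'_equivalent:
  assumes G: "g = R2'"
  shows "\<exists>J' \<Omega>. kahler_list g J' \<Omega> \<and> equivalent_cs (bracket g) J J'"
proof -
  have br: "bracket g x y = (x$1 * y$3 - x$3 * y$1 - x$2 * y$4 + x$4 * y$2) *\<^sub>R bv 3
    + (x$1 * y$4 - x$4 * y$1 + x$2 * y$3 - x$3 * y$2) *\<^sub>R bv 4" for x y
    by (simp add: G coord_simps)
  obtain a12 a b d e f where w: "\<omega> = two_form a12 a b d e f" and pf: "a12 * f - a * e + b * d \<noteq> 0"
    by (rule obtain_two_form)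
  have de: "d = b" "e = - a" "f = 0"
    using closed[of "bv 1" "bv 2" "bv 3"] closed[of "bv 1" "bv 2" "bv 4"] closed[of "bv 1" "bv 3" "bv 4"]
    by (simp_all add: br bv_nth bilinear_lzero[OF bilinear_two_form] bilinear_lneg[OF bilinear_two_form] w two_form_bv)
  have ab: "a * a + b * b \<noteq> 0" using pf de by simp
  define P where "P = J (bv 3)"
  define Q where "Q = J (bv 4)"
  have P: "J (bv 3) = P" and Q: "J (bv 4) = Q" by (simp_all add: P_def Q_def)
  have "bracket g P Q = (- P$2 - Q$1) *\<^sub>R P + (P$1 - Q$2) *\<^sub>R Q"
    using nijenhuis[of "bv 3" "bv 4"]
    unfolding P Q
    by (simp add: br[of "bv 3" "bv 4"] br[of P "bv 4"] br[of "bv 3" Q] bv_nth J_simps P Q)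
      (simp add: algebra_simps)
  then have "bracket g P Q $ i = ((- P$2 - Q$1) *\<^sub>R P + (P$1 - Q$2) *\<^sub>R Q) $ i" for i by simp
  from this[of 1] this[of 2] this[of 3] this[of 4]
  have N: "0 = (- P$2 - Q$1) * P$1 + (P$1 - Q$2) * Q$1"
    "0 = (- P$2 - Q$1) * P$2 + (P$1 - Q$2) * Q$2"
    "P$1 * Q$3 - P$3 * Q$1 - P$2 * Q$4 + P$4 * Q$2 = (- P$2 - Q$1) * P$3 + (P$1 - Q$2) * Q$3"
    "P$1 * Q$4 - P$4 * Q$1 + P$2 * Q$3 - P$3 * Q$2 = (- P$2 - Q$1) * P$4 + (P$1 - Q$2) * Q$4"
    by (simp_all add: br bv_nth)
  show ?thesis
  proof (cases "P$1 * Q$2 - P$2 * Q$1 = 0")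
    case False
    define D where "D = P$1 * Q$2 - P$2 * Q$1"
    \<comment> \<open>The first two components are a linear system of determinant D; its trivial
      solution means J e_4 = i J e_3 modulo [g, g].\<close>
    have "(P$2 + Q$1) * D = 0" "(P$1 - Q$2) * D = 0" using N D_def by algebra+
    then have q: "Q$1 = - P$2" "Q$2 = P$1" using False D_def by auto
    have pp: "P$1 * P$1 + P$2 * P$2 \<noteq> 0" using False q by simp
    have "(P$1 * P$1 + P$2 * P$2) * (Q$3 + P$4) = 0" "(P$1 * P$1 + P$2 * P$2) * (Q$4 - P$3) = 0"
      using N q by algebra+
    then have q34: "Q$3 = - P$4" "Q$4 = P$3" using pp by auto
    define r where "r = P$1 * P$1 + P$2 * P$2"
    \<comment> \<open>s + it is -1/(\<open>P$1\<close> + i \<open>P$2\<close>), the factor for which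
      J(s e_3 + t e_4) is -e_1 modulo [g, g].\<close>
    define s t where "s = - P$1 / r" and "t = P$2 / r"
    have r: "r \<noteq> 0" using pp by (simp add: r_def)
    have "s * r = - P$1" "t * r = P$2" using r by (simp_all add: s_def t_def)
    then have "(s * P$1 - t * P$2 + 1) * r = 0" "(s * P$2 + t * P$1) * r = 0"
      using r_def by algebra+
    then have st: "s * P$1 - t * P$2 = - 1" "s * P$2 + t * P$1 = 0" using r by auto
    have stn: "s * s + t * t \<noteq> 0"
      using st by (auto simp: sum_squares_eq_zero_iff)
    \<comment> \<open>The [g, g]-part of -J u_3, so that u_1 = -J u_3; u_2 and u_4 are i u_1 and i
      u_3.\<close>
    define m n where "m = - (s * P$3 - t * P$4)" and "n = - (s * P$4 + t * P$3)"
    let ?u1 = "bv 1 + m *\<^sub>R bv 3 + n *\<^sub>R bv 4" and ?u2 = "bv 2 + (- n) *\<^sub>R bv 3 + m *\<^sub>R bv 4"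
      and ?u3 = "s *\<^sub>R bv 3 + t *\<^sub>R bv 4" and ?u4 = "(- t) *\<^sub>R bv 3 + s *\<^sub>R bv 4"
    have j3: "J ?u3 = - ?u1"
      using st by (simp add: J_simps P Q vec_eq_iff forall_4 bv_nth q q34 m_def n_def algebra_simps)
    have j4: "J ?u4 = - ?u2"
      using st by (simp add: J_simps P Q vec_eq_iff forall_4 bv_nth q q34 m_def n_def algebra_simps)
    have j1: "J ?u1 = ?u3" and j2: "J ?u2 = ?u4"
      using J_uminus_flip[OF j3] J_uminus_flip[OF j4] by blast+
    have i: "independent4 ?u1 ?u2 ?u3 ?u4"
      unfolding independent4_def
    proof (intro allI impI)
      fix p q r s' assume "p *\<^sub>R ?u1 + q *\<^sub>R ?u2 + r *\<^sub>R ?u3 + s' *\<^sub>R ?u4 = 0"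
      then have c: "(p *\<^sub>R ?u1 + q *\<^sub>R ?u2 + r *\<^sub>R ?u3 + s' *\<^sub>R ?u4) $ i = 0" for i by simp
      have pq: "p = 0" "q = 0" using c[of 1] c[of 2] by (simp_all add: bv_nth)
      have "r * s - s' * t = 0" "r * t + s' * s = 0" using c[of 3] c[of 4] by (simp_all add: bv_nth pq)
      then have "r * (s * s + t * t) = 0" "s' * (s * s + t * t) = 0" by algebra+
      then show "p = 0 \<and> q = 0 \<and> r = 0 \<and> s' = 0" using pq stn by auto
    qed
    have b: "bracket g ?u1 ?u2 = 0" "bracket g ?u1 ?u3 = ?u3" "bracket g ?u1 ?u4 = ?u4"
      "bracket g ?u2 ?u3 = ?u4" "bracket g ?u2 ?u4 = - ?u3" "bracket g ?u3 ?u4 = 0"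
      by (simp_all add: br vec_eq_iff forall_4 bv_nth)
    have "equivalent_cs (bracket g) J (cs_ext [(1, 1, 3), (2, 1, 4)])"
      by (rule equivalent_csI'[OF linear_J linear_cs_ext i b j1 j2 j3 j4])
        (simp_all add: G frame_def coord_simps)
    then show ?thesis using G kahler_list.r2'_a by blast
  next
    case True
    \<comment> \<open>The e_2-component of integrability equates this sum with the vanishing
      determinant.\<close>
    have "P$2 * P$2 + Q$2 * Q$2 = 0" using N True by algebra
    then have pq2: "P$2 = 0" "Q$2 = 0" by (simp_all add: sum_squares_eq_zero_iff)
    have pq1: "P$1 = 0" "Q$1 = 0"
    proof -
      define v where "v = Q$1 *\<^sub>R bv 3 - P$1 *\<^sub>R bv 4"
      have Jv: "J v = Q$1 *\<^sub>R P - P$1 *\<^sub>R Q" by (simp add: v_def J_simps P Q)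
      define s t where "s = J v $ 3" and "t = J v $ 4"
      have st: "s = Q$1 * P$3 - P$1 * Q$3" "t = Q$1 * P$4 - P$1 * Q$4" by (simp_all add: s_def t_def Jv)
      have "J v $ 1 = 0" "J v $ 2 = 0" by (simp_all add: Jv pq2)
      then have e: "s * P$1 + t * Q$1 = 0" "s * P$3 + t * Q$3 = - Q$1" "s * P$4 + t * Q$4 = P$1"
        using J_J_component[of v 1] J_J_component[of v 3] J_J_component[of v 4]
        unfolding P Q s_def[symmetric] t_def[symmetric]
        by (simp_all add: v_def bv_nth)
      have "s * s + Q$1 * Q$1 = 0" "t * t + P$1 * P$1 = 0" using e st by algebra+
      then show "P$1 = 0" "Q$1 = 0" by (simp_all add: sum_squares_eq_zero_iff)
    qed
    have JJ: "P$3 * P$3 + P$4 * Q$3 = - 1" "P$3 * P$4 + P$4 * Q$4 = 0" "Q$3 * P$4 + Q$4 * Q$4 = - 1"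
      using J_J_component[of "bv 3" 3] J_J_component[of "bv 3" 4] J_J_component[of "bv 4" 4]
      by (simp_all add: P Q pq1 pq2 bv_nth)
    have P4: "P$4 \<noteq> 0"
    proof
      assume "P$4 = 0"
      then have "P$3 * P$3 = - 1" using JJ by simp
      then show False using zero_le_square[of "P$3"] by linarith
    qed
    have "P$4 * (Q$4 + P$3) = 0" using JJ(2) by algebra
    then have Q4: "Q$4 = - P$3" using P4 by simp
    define y where "y = J (bv 1)"
    have y: "J (bv 1) = y" by (simp add: y_def)
    have y2: "y$2 \<noteq> 0"
    proof
      assume "y$2 = 0"
      then have "y$1 * y$1 = - 1"
        using J_J_component[of "bv 1" 1] by (simp add: y P Q pq1 bv_nth)
      then show False using zero_le_square[of "y$1"] by linarith
    qed
    have "bracket g y P = bv 3 + J (bracket g y (bv 3)) + J (bracket g (bv 1) P)"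
      using nijenhuis[of "bv 1" "bv 3"] unfolding y P by (simp add: br[of "bv 1" "bv 3"] bv_nth)
    also have "\<dots> = bv 3 + (y$1 *\<^sub>R P + y$2 *\<^sub>R Q) + (P$3 *\<^sub>R P + P$4 *\<^sub>R Q)"
      by (simp add: br[of y "bv 3"] br[of "bv 1" P] bv_nth J_simps P Q pq1 pq2)
    finally have "bracket g y P $ i = (bv 3 + (y$1 *\<^sub>R P + y$2 *\<^sub>R Q) + (P$3 *\<^sub>R P + P$4 *\<^sub>R Q)) $ i" for i
      by simp
    from this[of 3] this[of 4]
    have "y$1 * P$3 - y$2 * P$4 = 1 + (y$1 * P$3 + y$2 * Q$3) + (P$3 * P$3 + P$4 * Q$3)"
      "y$1 * P$4 + y$2 * P$3 = (y$1 * P$4 + y$2 * Q$4) + (P$3 * P$4 + P$4 * Q$4)"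
      by (simp_all add: br bv_nth pq1 pq2)
    then have "y$2 * (Q$3 + P$4) = 0" "y$2 * (Q$4 - P$3) = 0" using JJ by algebra+
    \<comment> \<open>J commutes with i on [g, g], hence is i or -i there; s is this sign.\<close>
    then have Q34: "Q$3 = - P$4" "P$3 = 0" "Q$4 = 0" using y2 Q4 by auto
    define s where "s = P$4"
    have ss: "s * s = 1" using JJ Q34 by (simp add: s_def)
    then have s1: "s \<noteq> 0" by auto
    have Pv: "P = s *\<^sub>R bv 4" and Qv: "Q = (- s) *\<^sub>R bv 3"
      using Q34 pq1 pq2 by (simp_all add: vec_eq_iff forall_4 bv_nth s_def)
    \<comment> \<open>Compatibility fixes J e_1 modulo [g, g]: its coordinates solve a linear system
      of determinant a^2 + b^2.\<close>
    have "\<omega> y P = \<omega> (bv 1) (bv 3)" "\<omega> y Q = \<omega> (bv 1) (bv 4)"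
      using \<omega>_J[of "bv 1" "bv 3"] \<omega>_J[of "bv 1" "bv 4"] by (simp_all add: y P Q)
    then have E: "s * (b * y$1 - a * y$2) = a" "s * (a * y$1 + b * y$2) = - b"
      by (simp_all add: w Pv Qv two_form_def ee_def bv_nth de algebra_simps)
    have "s * ((a * a + b * b) * y$1) = b * (s * (b * y$1 - a * y$2)) + a * (s * (a * y$1 + b * y$2))"
      by (simp add: algebra_simps)
    also have "\<dots> = 0" unfolding E by simp
    finally have y1: "s * ((a * a + b * b) * y$1) = 0" .
    have "(a * a + b * b) * (s * y$2 + 1) =
        b * (s * (a * y$1 + b * y$2)) - a * (s * (b * y$1 - a * y$2)) + a * a + b * b"
      by (simp add: algebra_simps)
    also have "\<dots> = 0" unfolding E by simp
    finally have "(a * a + b * b) * (s * y$2 + 1) = 0" .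
    with y1 have y12: "y$1 = 0" and "s * y$2 = - 1" using ab s1 by auto
    then have "s * (s * y$2) = s * (- 1)" by simp
    then have y12: "y$1 = 0" "y$2 = - s" using y12 ss by (simp_all add: mult.assoc[symmetric])
    \<comment> \<open>Among the vectors u_1 = e_1 + (an element of [g, g]), the halves single out
      the one that commutes with u_2 = -J u_1.\<close>
    let ?u1 = "bv 1 + (- s * y$4 / 2) *\<^sub>R bv 3 + (s * y$3 / 2) *\<^sub>R bv 4"
      and ?u2 = "s *\<^sub>R bv 2 + (- y$3 / 2) *\<^sub>R bv 3 + (- y$4 / 2) *\<^sub>R bv 4"
      and ?u3 = "bv 3" and ?u4 = "s *\<^sub>R bv 4"
    have j1: "J ?u1 = - ?u2"
      using ss by (simp add: J_simps y P Q vec_eq_iff forall_4 bv_nth y12 Pv Qv)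
    have j2: "J ?u2 = ?u1"
      using J_uminus_flip[OF j1] .
    have j3: "J ?u3 = ?u4" by (simp add: P Pv)
    have j4: "J ?u4 = - ?u3" using ss by (simp add: J_simps Q Qv)
    have i: "independent4 ?u1 ?u2 ?u3 ?u4"
      unfolding independent4_def
    proof (intro allI impI)
      fix p q r t assume "p *\<^sub>R ?u1 + q *\<^sub>R ?u2 + r *\<^sub>R ?u3 + t *\<^sub>R ?u4 = 0"
      then have c: "(p *\<^sub>R ?u1 + q *\<^sub>R ?u2 + r *\<^sub>R ?u3 + t *\<^sub>R ?u4) $ i = 0" for i by simp
      have pq: "p = 0" "q = 0" using c[of 1] c[of 2] s1 by (simp_all add: bv_nth)
      then show "p = 0 \<and> q = 0 \<and> r = 0 \<and> t = 0" using c[of 3] c[of 4] s1 by (simp add: bv_nth)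
    qed
    have b: "bracket g ?u1 ?u2 = 0" "bracket g ?u1 ?u3 = ?u3" "bracket g ?u1 ?u4 = ?u4"
      "bracket g ?u2 ?u3 = ?u4" "bracket g ?u2 ?u4 = - ?u3" "bracket g ?u3 ?u4 = 0"
      using ss by (simp_all add: br vec_eq_iff forall_4 bv_nth algebra_simps)
    have "equivalent_cs (bracket g) J (cs_ext [(1, -1, 2), (3, 1, 4)])"
      by (rule equivalent_csI'[OF linear_J linear_cs_ext i b j1 j2 j3 j4])
        (simp_all add: G frame_def coord_simps)
    then show ?thesis using G kahler_list.r2'_b by blast
  qed
qed

text \<open>The abelian algebra is excluded since it has no entry in the list, although it does
  carry compatible pairs.\<close>

lemma equivalent_to_listed:
  assumes "valid_params g" "g \<noteq> A4"
  shows "\<exists>J' \<Omega>. kahler_list g J' \<Omega> \<and> equivalent_cs (bracket g) J J'"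
proof (cases g)
  case A4
  then show ?thesis using assms by simp
next
  case RR3
  then show ?thesis using not_RR3 by simp
next
  case N4
  then show ?thesis using not_N4 by simp
next
  case R4
  then show ?thesis using not_R4 by simp
next
  case (R4_mu m)
  then show ?thesis using not_R4_mu by simp
next
  case D4
  then show ?thesis using not_D4 by simp
next
  case H4
  then show ?thesis using not_H4 by simp
qed (fact RH3_equivalent RR3_lam_equivalent RR3'_gam_equivalent R2R2_equivalent R2'_equivalent
    R4_ab_equivalent[OF _ assms(1)] R4'_gd_equivalent[OF _ assms(1)]
    D4_lam_equivalent[OF _ assms(1)] D4'_del_equivalent[OF _ assms(1)])+

end

theorem proposition5p1:
  shows "(\<forall>g J \<Omega>. kahler_list g J \<Omega> \<longrightarrow>
            valid_params g \<and> complex_structure (bracket g) J \<and>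
            {\<omega>. symplectic_form (bracket g) \<omega> \<and> compatible J \<omega>} = \<Omega>) \<and>
         (\<forall>g J \<omega>. valid_params g \<and> g \<noteq> A4 \<and> complex_structure (bracket g) J \<and>
            symplectic_form (bracket g) \<omega> \<and> compatible J \<omega> \<longrightarrow>
            (\<exists>J' \<Omega>. kahler_list g J' \<Omega> \<and> equivalent_cs (bracket g) J J'))"
  using kahler_list_sound pseudo_kahler.equivalent_to_listed[OF pseudo_kahler.intro] by blast

end
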